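(* Let $G$ be a partially ordered group and let $C$ be a right pre-order on $G$ (identified with its pre-cone). The following are equivalent: (1) $C\in\mathscr{P}_{\mathsf R}(G)$, i.e. the $\ell$-group $H_C$ is representable; (2) the $\ell$-group $H_C$ is totally ordered; (3) for every $a\in G$, either $bab^{-1}\in C$ for every $b\in G$, or $bab^{-1}\in C^{-1}$ for every $b\in G$.
   Context: A partially ordered group is a group $G$ (identity $\mathrm{e}$) with a partial order such that $a\le b$ implies $sat\le sbt$; $G^+=\{a\mid a\ge \mathrm{e}\}$. An $\ell$-group is a partially ordered group whose order is a lattice; an $\ell$-subgroup is a sublattice subgroup. An $\ell$-group is representable if it is a subdirect product of totally ordered groups; $\mathsf R$ is the variety of representable $\ell$-groups. A right pre-order on $G$ is a reflexive, transitive, total relation $\preceq$ on $G$, with $\preceq\ne G\times G$, extending the partial order of $G$ and such that $a\preceq b\Rightarrow at\preceq bt$. It is identified with its pre-cone $C=\{a\mid \mathrm{e}\preceq a\}$; pre-cones are exactly the proper submonoids $C\subsetneq G$ with $G=C\cup C^{-1}$ and $G^+\subseteq C$, and $a\preceq_C b$ iff $ba^{-1}\in C$. Put $a\equiv_C b$ iff $a\preceq_C b$ and $b\preceq_C a$; $\Omega_C=G/{\equiv_C}$ is a chain with $[a]\le_C[b]$ iff $a\preceq_C b$. $\mathrm{Aut}\,\Omega_C$ is the $\ell$-group of order-preserving bijections of $\Omega_C$, where $f\cdot g$ means "$g$ after $f$" and lattice operations are pointwise. With $R_C(a)\colon[b]\mapsto[ba]$, $H_C$ is the $\ell$-subgroup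 of $\mathrm{Aut}\,\Omega_C$ generated by $R_C[G]$. $\mathscr{P}_{\mathsf R}(G)$ is the set of right pre-orders $C$ on $G$ with $H_C\in\mathsf R$. *)

theory Defs
  imports
    "HOL-Algebra.Lattice"
    "HOL-Algebra.Bij"
    "HOL-Algebra.Coset"
    "HOL-Algebra.Product_Groups"
begin

section \<open>Partially ordered groups\<close>

record 'a pogroup = "'a monoid" +
  leq :: "'a \<Rightarrow> 'a \<Rightarrow> bool" (infixl \<open>\<preceq>\<index>\<close> 50)

definition ord_of :: "('a, 'm) pogroup_scheme \<Rightarrow> 'a gorder" where
  "ord_of G = \<lparr>carrier = carrier G, eq = (=), le = leq G\<rparr>"

locale po_group = group G for G :: "('a, 'm) pogroup_scheme" (structure) +
  assumes ord: "partial_order (ord_of G)"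
    and leq_translate:
      "\<lbrakk>a \<preceq> b; a \<in> carrier G; b \<in> carrier G; s \<in> carrier G; t \<in> carrier G\<rbrakk>
        \<Longrightarrow> s \<otimes> a \<otimes> t \<preceq> s \<otimes> b \<otimes> t"

locale l_group = po_group +
  assumes lat: "lattice (ord_of G)"

locale totally_ordered_group = po_group +
  assumes tot: "total_order (ord_of G)"

definition l_subgroup :: "'a set \<Rightarrow> ('a, 'm) pogroup_scheme \<Rightarrow> bool" where
  "l_subgroup S L \<longleftrightarrow> subgroup S L \<and>
     (\<forall>x\<in>S. \<forall>y\<in>S. x \<squnion>\<^bsub>ord_of L\<^esub> y \<in> S \<and> x \<sqinter>\<^bsub>ord_of L\<^esub> y \<in> S)"

definition l_generate :: "('a, 'm) pogroup_scheme \<Rightarrow> 'a set \<Rightarrow> 'a set" where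
  "l_generate L X = \<Inter>{S. l_subgroup S L \<and> X \<subseteq> S}"


section \<open>Representable l-groups\<close>

definition l_hom :: "('a, 'm) pogroup_scheme \<Rightarrow> ('b, 'n) pogroup_scheme \<Rightarrow> ('a \<Rightarrow> 'b) set" where
  "l_hom A B = {h \<in> hom A B. join_pres (ord_of A) (ord_of B) h \<and> meet_pres (ord_of A) (ord_of B) h}"

definition product_pogroup ::
    "'i set \<Rightarrow> ('i \<Rightarrow> ('b, 'n) pogroup_scheme) \<Rightarrow> ('i \<Rightarrow> 'b) pogroup" where
  "product_pogroup I F =
     \<lparr>carrier = carrier (product_group I F),
      mult = mult (product_group I F),
      one = one (product_group I F),
      leq = (\<lambda>x y. \<forall>i\<in>I. x i \<preceq>\<^bsub>F i\<^esub> y i)\<rparr>"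

definition subdirect_embedding ::
    "('a, 'm) pogroup_scheme \<Rightarrow> 'i set \<Rightarrow> ('i \<Rightarrow> ('b, 'n) pogroup_scheme) \<Rightarrow> ('a \<Rightarrow> 'i \<Rightarrow> 'b) \<Rightarrow> bool"
  where
  "subdirect_embedding H I F h \<longleftrightarrow>
     h \<in> l_hom H (product_pogroup I F) \<and> inj_on h (carrier H) \<and>
     (\<forall>i\<in>I. (\<lambda>x. h x i) ` carrier H = carrier (F i))"

text \<open>
  HOL cannot quantify over the types of the index set and of the factors, so both are taken
  to be the type of \<^term>\<open>H\<close>. Nothing is lost: every factor is a quotient of \<^term>\<open>H\<close>, and
  one factor for each non-identity element of \<^term>\<open>H\<close> suffices to separate points. The lemma
  \<open>representableI\<close> below proves that a subdirect embedding with index set and factors of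
  arbitrary types makes \<^term>\<open>H\<close> representable.
\<close>

definition representable :: "('a, 'm) pogroup_scheme \<Rightarrow> bool" where
  "representable H \<longleftrightarrow> l_group H \<and>
     (\<exists>(I :: 'a set) (F :: 'a \<Rightarrow> 'a pogroup) h.
        (\<forall>i\<in>I. totally_ordered_group (F i)) \<and> subdirect_embedding H I F h)"


section \<open>Right pre-orders\<close>

definition right_preorder :: "('a, 'm) pogroup_scheme \<Rightarrow> 'a rel \<Rightarrow> bool" where
  "right_preorder G r \<longleftrightarrow>
     preorder_on (carrier G) r \<and> total_on (carrier G) r \<and> r \<noteq> carrier G \<times> carrier G \<and>
     (\<forall>a\<in>carrier G. \<forall>b\<in>carrier G. a \<preceq>\<^bsub>G\<^esub> b \<longrightarrow> (a, b) \<in> r) \<and>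
     (\<forall>a b. \<forall>t\<in>carrier G. (a, b) \<in> r \<longrightarrow> (a \<otimes>\<^bsub>G\<^esub> t, b \<otimes>\<^bsub>G\<^esub> t) \<in> r)"

definition pre_cone :: "('a, 'm) pogroup_scheme \<Rightarrow> 'a rel \<Rightarrow> 'a set" where
  "pre_cone G r = {a \<in> carrier G. (\<one>\<^bsub>G\<^esub>, a) \<in> r}"

text \<open>
  The chain of classes. By \<open>Omega_class_le_iff\<close> below, its order does not depend on the
  choice of representatives.
\<close>

definition Omega :: "('a, 'm) pogroup_scheme \<Rightarrow> 'a rel \<Rightarrow> 'a set gorder" where
  "Omega G r =
     \<lparr>carrier = carrier G // (r \<inter> r\<inverse>),
      eq = (=),
      le = (\<lambda>X Y. \<exists>a\<in>X. \<exists>b\<in>Y. (a, b) \<in> r)\<rparr>"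

text \<open>
  The product \<open>f \<cdot> g\<close> of two automorphisms is \<open>g\<close> after \<open>f\<close>, the opposite of the
  convention of \<^const>\<open>BijGroup\<close>. As there, maps are extensional, so that equality of maps
  is equality on \<^term>\<open>carrier X\<close>.
\<close>

definition Aut :: "'b gorder \<Rightarrow> ('b \<Rightarrow> 'b) pogroup" where
  "Aut X =
     \<lparr>carrier = {f \<in> Bij (carrier X). \<forall>x\<in>carrier X. \<forall>y\<in>carrier X. x \<sqsubseteq>\<^bsub>X\<^esub> y \<longrightarrow> f x \<sqsubseteq>\<^bsub>X\<^esub> f y},
      mult = (\<lambda>f g. compose (carrier X) g f),
      one = (\<lambda>x\<in>carrier X. x),
      leq = (\<lambda>f g. \<forall>x\<in>carrier X. f x \<sqsubseteq>\<^bsub>X\<^esub> g x)\<rparr>"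

text \<open>The map \<open>[b] \<mapsto> [ba]\<close>, written as a union over representatives of the class.\<close>

definition right_reg :: "('a, 'm) pogroup_scheme \<Rightarrow> 'a rel \<Rightarrow> 'a \<Rightarrow> 'a set \<Rightarrow> 'a set" where
  "right_reg G r a = (\<lambda>X\<in>carrier (Omega G r). \<Union>b\<in>X. (r \<inter> r\<inverse>) `` {b \<otimes>\<^bsub>G\<^esub> a})"

definition H_of :: "('a, 'm) pogroup_scheme \<Rightarrow> 'a rel \<Rightarrow> ('a set \<Rightarrow> 'a set) pogroup" where
  "H_of G r = (Aut (Omega G r))
     \<lparr>carrier := l_generate (Aut (Omega G r)) (right_reg G r ` carrier G)\<rparr>"

definition P_R :: "('a, 'm) pogroup_scheme \<Rightarrow> 'a rel set" where
  "P_R G = {r. right_preorder G r \<and> representable (H_of G r)}"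


section \<open>The constructions are well defined\<close>

lemma ord_of_simps [simp]:
  "carrier (ord_of G) = carrier G" "eq (ord_of G) = (=)" "le (ord_of G) = leq G"
  by (simp_all add: ord_of_def)

lemma partial_order_iff:
  assumes "eq L = (=)"
  shows "partial_order L \<longleftrightarrow>
    (\<forall>x\<in>carrier L. x \<sqsubseteq>\<^bsub>L\<^esub> x) \<and>
    (\<forall>x\<in>carrier L. \<forall>y\<in>carrier L. x \<sqsubseteq>\<^bsub>L\<^esub> y \<and> y \<sqsubseteq>\<^bsub>L\<^esub> x \<longrightarrow> x = y) \<and>
    (\<forall>x\<in>carrier L. \<forall>y\<in>carrier L. \<forall>z\<in>carrier L. x \<sqsubseteq>\<^bsub>L\<^esub> y \<and> y \<sqsubseteq>\<^bsub>L\<^esub> z \<longrightarrow> x \<sqsubseteq>\<^bsub>L\<^esub> z)"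
    (is "?l = ?r")
proof
  assume ?l
  then interpret partial_order L .
  show ?r using le_refl weak_le_antisym le_trans eq_is_equal by (metis (full_types))
next
  assume r: ?r
  show ?l
    by (unfold_locales; (simp only: assms)?; (use r in blast)?)
qed

lemma least_Upper_pair:
  assumes "x \<in> carrier L" "y \<in> carrier L"
  shows "least L s (Upper L {x, y}) \<longleftrightarrow>
    s \<in> carrier L \<and> x \<sqsubseteq>\<^bsub>L\<^esub> s \<and> y \<sqsubseteq>\<^bsub>L\<^esub> s \<and> (\<forall>z\<in>carrier L. x \<sqsubseteq>\<^bsub>L\<^esub> z \<and> y \<sqsubseteq>\<^bsub>L\<^esub> z \<longrightarrow> s \<sqsubseteq>\<^bsub>L\<^esub> z)"
  using assms by (auto simp: least_def Upper_def)

lemma greatest_Lower_pair: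
  assumes "x \<in> carrier L" "y \<in> carrier L"
  shows "greatest L s (Lower L {x, y}) \<longleftrightarrow>
    s \<in> carrier L \<and> s \<sqsubseteq>\<^bsub>L\<^esub> x \<and> s \<sqsubseteq>\<^bsub>L\<^esub> y \<and> (\<forall>z\<in>carrier L. z \<sqsubseteq>\<^bsub>L\<^esub> x \<and> z \<sqsubseteq>\<^bsub>L\<^esub> y \<longrightarrow> z \<sqsubseteq>\<^bsub>L\<^esub> s)"
  using assms by (auto simp: greatest_def Lower_def)

lemma join_eqI:
  assumes "partial_order L" "least L s (Upper L {x, y})"
  shows "x \<squnion>\<^bsub>L\<^esub> y = s"
proof -
  interpret partial_order L by fact
  show ?thesis unfolding join_def sup_def
    using assms(2) least_unique eq_is_equal by (metis someI_ex)
qed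

lemma meet_eqI:
  assumes "partial_order L" "greatest L s (Lower L {x, y})"
  shows "x \<sqinter>\<^bsub>L\<^esub> y = s"
proof -
  interpret partial_order L by fact
  show ?thesis unfolding meet_def inf_def
    using assms(2) greatest_unique eq_is_equal by (metis someI_ex)
qed

lemma lattice_iff:
  "lattice L \<longleftrightarrow> partial_order L \<and>
    (\<forall>x\<in>carrier L. \<forall>y\<in>carrier L. \<exists>s. least L s (Upper L {x, y})) \<and>
    (\<forall>x\<in>carrier L. \<forall>y\<in>carrier L. \<exists>s. greatest L s (Lower L {x, y}))"
  by (auto simp: lattice_def upper_semilattice_def lower_semilattice_def
      upper_semilattice_axioms_def lower_semilattice_axioms_def)

lemma lattice_join:
  assumes "lattice L" "x \<in> carrier L" "y \<in> carrier L"
  shows "least L (x \<squnion>\<^bsub>L\<^esub> y) (Upper L {x, y})"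
  using assms join_eqI by (metis lattice_iff)

lemma lattice_meet:
  assumes "lattice L" "x \<in> carrier L" "y \<in> carrier L"
  shows "greatest L (x \<sqinter>\<^bsub>L\<^esub> y) (Lower L {x, y})"
  using assms meet_eqI by (metis lattice_iff)

lemma lattice_leq_iff_join:
  assumes "lattice L" "x \<in> carrier L" "y \<in> carrier L"
  shows "x \<sqsubseteq>\<^bsub>L\<^esub> y \<longleftrightarrow> x \<squnion>\<^bsub>L\<^esub> y = y"
proof
  interpret lattice L by fact
  assume "x \<sqsubseteq>\<^bsub>L\<^esub> y"
  then have "least L y (Upper L {x, y})"
    using assms by (auto simp: least_Upper_pair)
  then show "x \<squnion>\<^bsub>L\<^esub> y = y" by (rule join_eqI[OF partial_order_axioms])
next
  assume "x \<squnion>\<^bsub>L\<^esub> y = y"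
  then show "x \<sqsubseteq>\<^bsub>L\<^esub> y" using lattice_join[OF assms] assms by (simp add: least_Upper_pair)
qed

sublocale totally_ordered_group \<subseteq> l_group
proof (intro l_group.intro l_group_axioms.intro)
  show "po_group G" by (rule po_group_axioms)
  interpret T: total_order "ord_of G" by (rule tot)
  show "lattice (ord_of G)" by (rule T.lattice_axioms)
qed

text \<open>An l-subgroup is an l-group with the same joins and meets.\<close>

lemma l_subgroup_l_group:
  fixes L :: "('a, 'm) pogroup_scheme"
  assumes "l_group L" "l_subgroup S L"
  shows "l_group (L\<lparr>carrier := S\<rparr>)"
    and "x \<in> S \<Longrightarrow> y \<in> S \<Longrightarrow> x \<squnion>\<^bsub>ord_of (L\<lparr>carrier := S\<rparr>)\<^esub> y = x \<squnion>\<^bsub>ord_of L\<^esub> y"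
    and "x \<in> S \<Longrightarrow> y \<in> S \<Longrightarrow> x \<sqinter>\<^bsub>ord_of (L\<lparr>carrier := S\<rparr>)\<^esub> y = x \<sqinter>\<^bsub>ord_of L\<^esub> y"
proof -
  interpret l_group L by fact
  let ?M = "L\<lparr>carrier := S\<rparr>"
  have sg: "subgroup S L" and SL: "S \<subseteq> carrier L"
    using assms(2) by (auto simp: l_subgroup_def subgroup.subset)
  interpret M: group ?M by (rule subgroup.subgroup_is_group[OF sg is_group])
  have po: "partial_order (ord_of ?M)"
    using ord SL unfolding partial_order_iff[of "ord_of _", simplified] by (simp add: subset_iff) metis
  have j: "least (ord_of ?M) (x \<squnion>\<^bsub>ord_of L\<^esub> y) (Upper (ord_of ?M) {x, y})" if "x \<in> S" "y \<in> S" for x y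
    using lattice_join[OF lat, of x y] that SL assms(2)
    by (subst least_Upper_pair) (auto simp: least_Upper_pair l_subgroup_def subset_iff)
  have m: "greatest (ord_of ?M) (x \<sqinter>\<^bsub>ord_of L\<^esub> y) (Lower (ord_of ?M) {x, y})" if "x \<in> S" "y \<in> S" for x y
    using lattice_meet[OF lat, of x y] that SL assms(2)
    by (subst greatest_Lower_pair) (auto simp: greatest_Lower_pair l_subgroup_def subset_iff)
  show "l_group ?M"
  proof (intro l_group.intro po_group.intro po_group_axioms.intro l_group_axioms.intro)
    show "lattice (ord_of ?M)" unfolding lattice_iff ord_of_simps using po j m by simp blast
    show "s \<otimes>\<^bsub>?M\<^esub> a \<otimes>\<^bsub>?M\<^esub> t \<preceq>\<^bsub>?M\<^esub> s \<otimes>\<^bsub>?M\<^esub> b \<otimes>\<^bsub>?M\<^esub> t"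
      if "a \<preceq>\<^bsub>?M\<^esub> b" "a \<in> carrier ?M" "b \<in> carrier ?M" "s \<in> carrier ?M" "t \<in> carrier ?M"
      for a b s t
      using that leq_translate[of a b s t] SL by (simp add: subset_iff)
  qed (fact M.is_group po)+
  show "x \<in> S \<Longrightarrow> y \<in> S \<Longrightarrow> x \<squnion>\<^bsub>ord_of ?M\<^esub> y = x \<squnion>\<^bsub>ord_of L\<^esub> y"
    using join_eqI[OF po j] .
  show "x \<in> S \<Longrightarrow> y \<in> S \<Longrightarrow> x \<sqinter>\<^bsub>ord_of ?M\<^esub> y = x \<sqinter>\<^bsub>ord_of L\<^esub> y"
    using meet_eqI[OF po m] .
qed

lemma l_generate_l_subgroup:
  assumes "l_group L" "X \<subseteq> carrier L"
  shows "l_subgroup (l_generate L X) L" "X \<subseteq> l_generate L X"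
proof -
  interpret l_group L by fact
  have "l_subgroup (carrier L) L"
    unfolding l_subgroup_def
    using subgroup_self lattice_join[OF lat] lattice_meet[OF lat]
    by (auto simp: least_Upper_pair greatest_Lower_pair)
  then have ne: "{S. l_subgroup S L \<and> X \<subseteq> S} \<noteq> {}" using assms(2) by blast
  have "subgroup (l_generate L X) L"
    unfolding l_generate_def using ne
    by (intro subgroups_Inter) (auto simp: l_subgroup_def)
  then show "l_subgroup (l_generate L X) L"
    by (auto simp: l_subgroup_def l_generate_def)
  show "X \<subseteq> l_generate L X" by (auto simp: l_generate_def)
qed

lemma product_pogroup_simps [simp]:
  "carrier (product_pogroup I F) = (\<Pi>\<^sub>E i\<in>I. carrier (F i))"
  "x \<otimes>\<^bsub>product_pogroup I F\<^esub> y = (\<lambda>i\<in>I. x i \<otimes>\<^bsub>F i\<^esub> y i)"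
  "\<one>\<^bsub>product_pogroup I F\<^esub> = (\<lambda>i\<in>I. \<one>\<^bsub>F i\<^esub>)"
  "x \<preceq>\<^bsub>product_pogroup I F\<^esub> y \<longleftrightarrow> (\<forall>i\<in>I. x i \<preceq>\<^bsub>F i\<^esub> y i)"
  by (simp_all add: product_pogroup_def product_group_def)

lemma product_l_group:
  assumes F: "\<And>i. i \<in> I \<Longrightarrow> l_group (F i)"
  shows "l_group (product_pogroup I F)"
    and "\<lbrakk>x \<in> carrier (product_pogroup I F); y \<in> carrier (product_pogroup I F)\<rbrakk> \<Longrightarrow>
      x \<squnion>\<^bsub>ord_of (product_pogroup I F)\<^esub> y = (\<lambda>i\<in>I. x i \<squnion>\<^bsub>ord_of (F i)\<^esub> y i)"
    and "\<lbrakk>x \<in> carrier (product_pogroup I F); y \<in> carrier (product_pogroup I F)\<rbrakk> \<Longrightarrow>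
      x \<sqinter>\<^bsub>ord_of (product_pogroup I F)\<^esub> y = (\<lambda>i\<in>I. x i \<sqinter>\<^bsub>ord_of (F i)\<^esub> y i)"
proof -
  let ?P = "product_pogroup I F"
  have gr: "group (F i)" and po: "partial_order (ord_of (F i))" and la: "lattice (ord_of (F i))"
    if "i \<in> I" for i
    using F[OF that] by (auto simp: l_group_def po_group_def po_group_axioms_def l_group_axioms_def)
  have "group (product_group I F)" using gr by simp
  moreover have "product_group I F = monoid.truncate ?P"
    by (simp add: product_pogroup_def monoid.truncate_def)
  ultimately have grP: "group ?P"
    unfolding Group.group_def group_axioms_def monoid_def Units_def monoid.truncate_def by simp
  have poP: "partial_order (ord_of ?P)"
    unfolding partial_order_iff[of "ord_of ?P", simplified] product_pogroup_simps
  proof (intro conjI ballI impI)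
    fix x y assume "x \<in> (\<Pi>\<^sub>E i\<in>I. carrier (F i))" "y \<in> (\<Pi>\<^sub>E i\<in>I. carrier (F i))"
      "(\<forall>i\<in>I. x i \<preceq>\<^bsub>F i\<^esub> y i) \<and> (\<forall>i\<in>I. y i \<preceq>\<^bsub>F i\<^esub> x i)"
    then show "x = y"
      using po[unfolded partial_order_iff[of "ord_of (F _)", simplified]]
      by (intro PiE_ext[of x I _ y]) (auto simp: PiE_iff)
  next
    fix x y z i
    assume "x \<in> (\<Pi>\<^sub>E i\<in>I. carrier (F i))" "y \<in> (\<Pi>\<^sub>E i\<in>I. carrier (F i))"
      "z \<in> (\<Pi>\<^sub>E i\<in>I. carrier (F i))" "i \<in> I"
      "(\<forall>i\<in>I. x i \<preceq>\<^bsub>F i\<^esub> y i) \<and> (\<forall>i\<in>I. y i \<preceq>\<^bsub>F i\<^esub> z i)"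
    moreover from this have "x i \<in> carrier (F i)" "y i \<in> carrier (F i)" "z i \<in> carrier (F i)" by auto
    ultimately show "x i \<preceq>\<^bsub>F i\<^esub> z i"
      using po[of i] unfolding partial_order_iff[of "ord_of (F i)", simplified] by blast
  next
    fix x i assume "x \<in> (\<Pi>\<^sub>E i\<in>I. carrier (F i))" "i \<in> I"
    then show "x i \<preceq>\<^bsub>F i\<^esub> x i"
      using po[of i] unfolding partial_order_iff[of "ord_of (F i)", simplified] by auto
  qed
  have j: "least (ord_of ?P) (\<lambda>i\<in>I. x i \<squnion>\<^bsub>ord_of (F i)\<^esub> y i) (Upper (ord_of ?P) {x, y})"
    if x: "x \<in> carrier ?P" and y: "y \<in> carrier ?P" for x y
  proof -
    have "least (ord_of (F i)) (x i \<squnion>\<^bsub>ord_of (F i)\<^esub> y i) (Upper (ord_of (F i)) {x i, y i})"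
      if "i \<in> I" for i using that x y by (intro lattice_join la) auto
    moreover have "x i \<in> carrier (F i)" "y i \<in> carrier (F i)" if "i \<in> I" for i
      using that x y by auto
    ultimately have *: "x i \<squnion>\<^bsub>ord_of (F i)\<^esub> y i \<in> carrier (F i)"
      "x i \<preceq>\<^bsub>F i\<^esub> x i \<squnion>\<^bsub>ord_of (F i)\<^esub> y i" "y i \<preceq>\<^bsub>F i\<^esub> x i \<squnion>\<^bsub>ord_of (F i)\<^esub> y i"
      "z \<in> carrier (F i) \<Longrightarrow> x i \<preceq>\<^bsub>F i\<^esub> z \<Longrightarrow> y i \<preceq>\<^bsub>F i\<^esub> z \<Longrightarrow> x i \<squnion>\<^bsub>ord_of (F i)\<^esub> y i \<preceq>\<^bsub>F i\<^esub> z"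
      if "i \<in> I" for i z using that by (auto simp: least_Upper_pair)
    show ?thesis using x y * by (subst least_Upper_pair) (auto simp: PiE_iff)
  qed
  have m: "greatest (ord_of ?P) (\<lambda>i\<in>I. x i \<sqinter>\<^bsub>ord_of (F i)\<^esub> y i) (Lower (ord_of ?P) {x, y})"
    if x: "x \<in> carrier ?P" and y: "y \<in> carrier ?P" for x y
  proof -
    have "greatest (ord_of (F i)) (x i \<sqinter>\<^bsub>ord_of (F i)\<^esub> y i) (Lower (ord_of (F i)) {x i, y i})"
      if "i \<in> I" for i using that x y by (intro lattice_meet la) auto
    moreover have "x i \<in> carrier (F i)" "y i \<in> carrier (F i)" if "i \<in> I" for i
      using that x y by auto
    ultimately have *: "x i \<sqinter>\<^bsub>ord_of (F i)\<^esub> y i \<in> carrier (F i)"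
      "x i \<sqinter>\<^bsub>ord_of (F i)\<^esub> y i \<preceq>\<^bsub>F i\<^esub> x i" "x i \<sqinter>\<^bsub>ord_of (F i)\<^esub> y i \<preceq>\<^bsub>F i\<^esub> y i"
      "z \<in> carrier (F i) \<Longrightarrow> z \<preceq>\<^bsub>F i\<^esub> x i \<Longrightarrow> z \<preceq>\<^bsub>F i\<^esub> y i \<Longrightarrow> z \<preceq>\<^bsub>F i\<^esub> x i \<sqinter>\<^bsub>ord_of (F i)\<^esub> y i"
      if "i \<in> I" for i z using that by (auto simp: greatest_Lower_pair)
    show ?thesis using x y * by (subst greatest_Lower_pair) (auto simp: PiE_iff)
  qed
  show "l_group ?P"
  proof (intro l_group.intro po_group.intro po_group_axioms.intro l_group_axioms.intro)
    show "lattice (ord_of ?P)" unfolding lattice_iff ord_of_simps using poP j m by blast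
    fix a b s t
    assume "a \<preceq>\<^bsub>?P\<^esub> b" and c: "a \<in> carrier ?P" "b \<in> carrier ?P" "s \<in> carrier ?P" "t \<in> carrier ?P"
    then have "a i \<preceq>\<^bsub>F i\<^esub> b i" "a i \<in> carrier (F i)" "b i \<in> carrier (F i)"
      "s i \<in> carrier (F i)" "t i \<in> carrier (F i)" if "i \<in> I" for i
      using that by auto
    then have "s i \<otimes>\<^bsub>F i\<^esub> a i \<otimes>\<^bsub>F i\<^esub> t i \<preceq>\<^bsub>F i\<^esub> s i \<otimes>\<^bsub>F i\<^esub> b i \<otimes>\<^bsub>F i\<^esub> t i" if "i \<in> I" for i
      using that po_group.leq_translate[OF l_group.axioms(1)[OF F[OF that]]] by blast
    then show "s \<otimes>\<^bsub>?P\<^esub> a \<otimes>\<^bsub>?P\<^esub> t \<preceq>\<^bsub>?P\<^esub> s \<otimes>\<^bsub>?P\<^esub> b \<otimes>\<^bsub>?P\<^esub> t"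
      by simp
  qed (fact grP poP)+
  show "\<lbrakk>x \<in> carrier ?P; y \<in> carrier ?P\<rbrakk> \<Longrightarrow>
      x \<squnion>\<^bsub>ord_of ?P\<^esub> y = (\<lambda>i\<in>I. x i \<squnion>\<^bsub>ord_of (F i)\<^esub> y i)"
    using join_eqI[OF poP j] .
  show "\<lbrakk>x \<in> carrier ?P; y \<in> carrier ?P\<rbrakk> \<Longrightarrow>
      x \<sqinter>\<^bsub>ord_of ?P\<^esub> y = (\<lambda>i\<in>I. x i \<sqinter>\<^bsub>ord_of (F i)\<^esub> y i)"
    using meet_eqI[OF poP m] .
qed


lemma Aut_simps [simp]:
  "f \<otimes>\<^bsub>Aut X\<^esub> g = compose (carrier X) g f"
  "\<one>\<^bsub>Aut X\<^esub> = (\<lambda>x\<in>carrier X. x)"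
  "f \<preceq>\<^bsub>Aut X\<^esub> g \<longleftrightarrow> (\<forall>x\<in>carrier X. f x \<sqsubseteq>\<^bsub>X\<^esub> g x)"
  by (simp_all add: Aut_def)

lemma carrier_Aut_iff:
  assumes "total_order X"
  shows "f \<in> carrier (Aut X) \<longleftrightarrow> f \<in> extensional (carrier X) \<and> f ` carrier X = carrier X \<and>
    (\<forall>x\<in>carrier X. \<forall>y\<in>carrier X. f x \<sqsubseteq>\<^bsub>X\<^esub> f y \<longleftrightarrow> x \<sqsubseteq>\<^bsub>X\<^esub> y)" (is "?l \<longleftrightarrow> ?r")
proof -
  interpret total_order X by fact
  have anti: "x = y" if "x \<sqsubseteq>\<^bsub>X\<^esub> y" "y \<sqsubseteq>\<^bsub>X\<^esub> x" "x \<in> carrier X" "y \<in> carrier X" for x y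
    using that weak_le_antisym eq_is_equal by metis
  show ?thesis
  proof
    assume l: ?l
    then have f: "f \<in> extensional (carrier X)" "f ` carrier X = carrier X" "inj_on f (carrier X)"
      and mono: "\<And>x y. x \<in> carrier X \<Longrightarrow> y \<in> carrier X \<Longrightarrow> x \<sqsubseteq>\<^bsub>X\<^esub> y \<Longrightarrow> f x \<sqsubseteq>\<^bsub>X\<^esub> f y"
      by (auto simp: Aut_def Bij_def bij_betw_def)
    have "x \<sqsubseteq>\<^bsub>X\<^esub> y" if "x \<in> carrier X" "y \<in> carrier X" "f x \<sqsubseteq>\<^bsub>X\<^esub> f y" for x y
    proof (rule ccontr)
      assume n: "\<not> x \<sqsubseteq>\<^bsub>X\<^esub> y"
      then have "y \<sqsubseteq>\<^bsub>X\<^esub> x" using total_order_total that by blast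
      then have "f x = f y" using mono that f(2) by (intro anti) auto
      then show False using f(3) that n by (auto dest: inj_onD)
    qed
    with f mono show ?r by blast
  next
    assume r: ?r
    then have "inj_on f (carrier X)" by (intro inj_onI) (metis anti le_refl)
    with r show ?l by (auto simp: Aut_def Bij_def bij_betw_def)
  qed
qed

text \<open>
  Over a chain, \<^const>\<open>Aut\<close> is an l-group and its lattice operations are computed pointwise.
\<close>

lemma Aut_l_group:
  assumes "total_order X"
  shows "l_group (Aut X)"
    and "\<lbrakk>f \<in> carrier (Aut X); g \<in> carrier (Aut X)\<rbrakk> \<Longrightarrow>
      f \<squnion>\<^bsub>ord_of (Aut X)\<^esub> g = (\<lambda>x\<in>carrier X. f x \<squnion>\<^bsub>X\<^esub> g x)"
    and "\<lbrakk>f \<in> carrier (Aut X); g \<in> carrier (Aut X)\<rbrakk> \<Longrightarrow>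
      f \<sqinter>\<^bsub>ord_of (Aut X)\<^esub> g = (\<lambda>x\<in>carrier X. f x \<sqinter>\<^bsub>X\<^esub> g x)"
proof -
  interpret total_order X by fact
  let ?S = "carrier X" and ?A = "Aut X"
  have anti: "x = y" if "x \<sqsubseteq>\<^bsub>X\<^esub> y" "y \<sqsubseteq>\<^bsub>X\<^esub> x" "x \<in> ?S" "y \<in> ?S" for x y
    using that weak_le_antisym eq_is_equal by metis
  note Aiff = carrier_Aut_iff[OF assms]
  have in_S: "f x \<in> ?S" if "f \<in> carrier ?A" "x \<in> ?S" for f x
    using that by (auto simp: Aiff)
  have grA: "group ?A"
  proof (rule groupI)
    show "f \<otimes>\<^bsub>?A\<^esub> g \<in> carrier ?A" if "f \<in> carrier ?A" "g \<in> carrier ?A" for f g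
    proof -
      have "compose ?S g f ` ?S = g ` (f ` ?S)" by (auto simp: compose_def image_iff)
      then show ?thesis using that in_S[OF that(1)] by (simp add: Aiff compose_eq)
    qed
    show "\<one>\<^bsub>?A\<^esub> \<in> carrier ?A" by (simp add: Aiff)
    show "f \<otimes>\<^bsub>?A\<^esub> g \<otimes>\<^bsub>?A\<^esub> h = f \<otimes>\<^bsub>?A\<^esub> (g \<otimes>\<^bsub>?A\<^esub> h)"
      if "f \<in> carrier ?A" "g \<in> carrier ?A" "h \<in> carrier ?A" for f g h
      using that in_S by (auto simp: compose_def fun_eq_iff)
    show "\<one>\<^bsub>?A\<^esub> \<otimes>\<^bsub>?A\<^esub> f = f" if "f \<in> carrier ?A" for f
      using that by (auto simp: compose_def fun_eq_iff Aiff extensional_def)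
    show "\<exists>g\<in>carrier ?A. g \<otimes>\<^bsub>?A\<^esub> f = \<one>\<^bsub>?A\<^esub>" if f: "f \<in> carrier ?A" for f
    proof
      let ?g = "\<lambda>y\<in>?S. inv_into ?S f y"
      have fg: "f (?g y) = y" and gS: "?g y \<in> ?S" if "y \<in> ?S" for y
        using that f by (auto simp: Aiff f_inv_into_f inv_into_into)
      have gf: "?g (f x) = x" if "x \<in> ?S" for x
      proof -
        have "f (?g (f x)) = f x" "?g (f x) \<in> ?S" using that fg gS in_S[OF f] by blast+
        then show ?thesis using f that anti le_refl by (metis Aiff)
      qed
      have "?g ` ?S = ?S"
      proof
        show "?g ` ?S \<subseteq> ?S" using gS by (intro image_subsetI)
        show "?S \<subseteq> ?g ` ?S" using gf in_S[OF f] by (metis imageI subsetI)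
      qed
      moreover have "?g x \<sqsubseteq>\<^bsub>X\<^esub> ?g y \<longleftrightarrow> x \<sqsubseteq>\<^bsub>X\<^esub> y" if "x \<in> ?S" "y \<in> ?S" for x y
        using f fg[OF that(1)] fg[OF that(2)] gS[OF that(1)] gS[OF that(2)] by (metis Aiff)
      ultimately show "?g \<in> carrier ?A" unfolding Aiff by (auto simp del: restrict_apply)
      show "?g \<otimes>\<^bsub>?A\<^esub> f = \<one>\<^bsub>?A\<^esub>" using fg by (auto simp: compose_def fun_eq_iff)
    qed
  qed
  have poA: "partial_order (ord_of ?A)"
    unfolding partial_order_iff[of "ord_of ?A", simplified] Aut_simps
  proof (intro conjI ballI impI)
    fix f g assume fg: "f \<in> carrier ?A" "g \<in> carrier ?A"
      and le: "(\<forall>x\<in>?S. f x \<sqsubseteq>\<^bsub>X\<^esub> g x) \<and> (\<forall>x\<in>?S. g x \<sqsubseteq>\<^bsub>X\<^esub> f x)"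
    have "f x = g x" if "x \<in> ?S" for x using that le in_S fg by (intro anti) auto
    then show "f = g" using fg by (intro extensionalityI[of f ?S]) (auto simp: Aiff)
  next
    fix f g h x assume "f \<in> carrier ?A" "g \<in> carrier ?A" "h \<in> carrier ?A" "x \<in> ?S"
      and "(\<forall>x\<in>?S. f x \<sqsubseteq>\<^bsub>X\<^esub> g x) \<and> (\<forall>x\<in>?S. g x \<sqsubseteq>\<^bsub>X\<^esub> h x)"
    then show "f x \<sqsubseteq>\<^bsub>X\<^esub> h x" using le_trans[of "f x" "g x" "h x"] in_S by blast
  qed (use in_S in auto)
  have jn: "x \<squnion>\<^bsub>X\<^esub> y = (if x \<sqsubseteq>\<^bsub>X\<^esub> y then y else x)" if "x \<in> ?S" "y \<in> ?S" for x y
    using that total_order_total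
    by (intro join_eqI[OF partial_order_axioms]) (auto simp: least_Upper_pair)
  have mt: "x \<sqinter>\<^bsub>X\<^esub> y = (if x \<sqsubseteq>\<^bsub>X\<^esub> y then x else y)" if "x \<in> ?S" "y \<in> ?S" for x y
    using that total_order_total
    by (intro meet_eqI[OF partial_order_axioms]) (auto simp: greatest_Lower_pair)
  have closed: "(\<lambda>x\<in>?S. f x \<squnion>\<^bsub>X\<^esub> g x) \<in> carrier ?A" "(\<lambda>x\<in>?S. f x \<sqinter>\<^bsub>X\<^esub> g x) \<in> carrier ?A"
    if fg: "f \<in> carrier ?A" "g \<in> carrier ?A" for f g
  proof -
    have f: "f x \<in> ?S" "g x \<in> ?S" if "x \<in> ?S" for x using that fg in_S by auto
    have mo: "f x \<sqsubseteq>\<^bsub>X\<^esub> f y \<longleftrightarrow> x \<sqsubseteq>\<^bsub>X\<^esub> y" "g x \<sqsubseteq>\<^bsub>X\<^esub> g y \<longleftrightarrow> x \<sqsubseteq>\<^bsub>X\<^esub> y" if "x \<in> ?S" "y \<in> ?S" for x y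
      using fg that by (auto simp: Aiff)
    have ex: "\<exists>x\<in>?S. f x = y \<and> g x \<sqsubseteq>\<^bsub>X\<^esub> y \<or> g x = y \<and> f x \<sqsubseteq>\<^bsub>X\<^esub> y"
         "\<exists>x\<in>?S. f x = y \<and> y \<sqsubseteq>\<^bsub>X\<^esub> g x \<or> g x = y \<and> y \<sqsubseteq>\<^bsub>X\<^esub> f x" if "y \<in> ?S" for y
    proof -
      have "y \<in> f ` ?S" "y \<in> g ` ?S" using that fg by (simp_all add: Aiff)
      then obtain a b where ab: "a \<in> ?S" "b \<in> ?S" "f a = y" "g b = y" by (elim imageE) simp
      consider "a \<sqsubseteq>\<^bsub>X\<^esub> b" | "b \<sqsubseteq>\<^bsub>X\<^esub> a" using total_order_total ab by blast
      then have "(f a = y \<and> g a \<sqsubseteq>\<^bsub>X\<^esub> y) \<and> (g b = y \<and> y \<sqsubseteq>\<^bsub>X\<^esub> f b) \<or>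
          (g b = y \<and> f b \<sqsubseteq>\<^bsub>X\<^esub> y) \<and> (f a = y \<and> y \<sqsubseteq>\<^bsub>X\<^esub> g a)"
        using ab mo(1)[of a b] mo(2)[of a b] mo(1)[of b a] mo(2)[of b a] by cases simp_all
      then show "\<exists>x\<in>?S. f x = y \<and> g x \<sqsubseteq>\<^bsub>X\<^esub> y \<or> g x = y \<and> f x \<sqsubseteq>\<^bsub>X\<^esub> y"
         "\<exists>x\<in>?S. f x = y \<and> y \<sqsubseteq>\<^bsub>X\<^esub> g x \<or> g x = y \<and> y \<sqsubseteq>\<^bsub>X\<^esub> f x" using ab by blast+
    qed
    have "(\<lambda>x\<in>?S. f x \<squnion>\<^bsub>X\<^esub> g x) ` ?S = ?S"
    proof
      show "?S \<subseteq> (\<lambda>x\<in>?S. f x \<squnion>\<^bsub>X\<^esub> g x) ` ?S"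
      proof
        fix y assume y: "y \<in> ?S"
        obtain x where "x \<in> ?S" "f x = y \<and> g x \<sqsubseteq>\<^bsub>X\<^esub> y \<or> g x = y \<and> f x \<sqsubseteq>\<^bsub>X\<^esub> y" using ex(1)[OF y] by blast
        then have "x \<in> ?S" "f x \<squnion>\<^bsub>X\<^esub> g x = y" using f[of x] anti by (auto simp: jn)
        then show "y \<in> (\<lambda>x\<in>?S. f x \<squnion>\<^bsub>X\<^esub> g x) ` ?S"
          by (intro image_eqI[of _ _ x]) simp_all
      qed
      show "(\<lambda>x\<in>?S. f x \<squnion>\<^bsub>X\<^esub> g x) ` ?S \<subseteq> ?S"
        using f by (intro image_subsetI) (simp add: jn)
    qed
    moreover have "f x \<squnion>\<^bsub>X\<^esub> g x \<sqsubseteq>\<^bsub>X\<^esub> f y \<squnion>\<^bsub>X\<^esub> g y \<longleftrightarrow> x \<sqsubseteq>\<^bsub>X\<^esub> y" if xy: "x \<in> ?S" "y \<in> ?S" for x y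
    proof -
      have up: "u \<sqsubseteq>\<^bsub>X\<^esub> u \<squnion>\<^bsub>X\<^esub> v" "v \<sqsubseteq>\<^bsub>X\<^esub> u \<squnion>\<^bsub>X\<^esub> v" "u \<squnion>\<^bsub>X\<^esub> v \<in> ?S" "u \<squnion>\<^bsub>X\<^esub> v = u \<or> u \<squnion>\<^bsub>X\<^esub> v = v"
        if "u \<in> ?S" "v \<in> ?S" for u v
        using that total_order_total[OF that] by (auto simp: jn)
      note fx = f[OF xy(1)] and fy = f[OF xy(2)]
      show ?thesis
      proof
        assume "x \<sqsubseteq>\<^bsub>X\<^esub> y"
        then have "f x \<sqsubseteq>\<^bsub>X\<^esub> f y" "g x \<sqsubseteq>\<^bsub>X\<^esub> g y" using mo[OF xy] by simp_all
        then have "f x \<sqsubseteq>\<^bsub>X\<^esub> f y \<squnion>\<^bsub>X\<^esub> g y" "g x \<sqsubseteq>\<^bsub>X\<^esub> f y \<squnion>\<^bsub>X\<^esub> g y"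
          using le_trans[OF _ up(1)[OF fy]] le_trans[OF _ up(2)[OF fy]] fx fy up(3)[OF fy] by blast+
        then show "f x \<squnion>\<^bsub>X\<^esub> g x \<sqsubseteq>\<^bsub>X\<^esub> f y \<squnion>\<^bsub>X\<^esub> g y" using up(4)[OF fx] by auto
      next
        assume "f x \<squnion>\<^bsub>X\<^esub> g x \<sqsubseteq>\<^bsub>X\<^esub> f y \<squnion>\<^bsub>X\<^esub> g y"
        then have "f x \<sqsubseteq>\<^bsub>X\<^esub> f y \<squnion>\<^bsub>X\<^esub> g y" "g x \<sqsubseteq>\<^bsub>X\<^esub> f y \<squnion>\<^bsub>X\<^esub> g y"
          using le_trans[OF up(1)[OF fx]] le_trans[OF up(2)[OF fx]] fx fy up(3)[OF fx] up(3)[OF fy] by blast+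
        then show "x \<sqsubseteq>\<^bsub>X\<^esub> y" using up(4)[OF fy] mo[OF xy] by auto
      qed
    qed
    ultimately show "(\<lambda>x\<in>?S. f x \<squnion>\<^bsub>X\<^esub> g x) \<in> carrier ?A" by (simp add: Aiff)
    have "(\<lambda>x\<in>?S. f x \<sqinter>\<^bsub>X\<^esub> g x) ` ?S = ?S"
    proof
      show "?S \<subseteq> (\<lambda>x\<in>?S. f x \<sqinter>\<^bsub>X\<^esub> g x) ` ?S"
      proof
        fix y assume y: "y \<in> ?S"
        obtain x where "x \<in> ?S" "f x = y \<and> y \<sqsubseteq>\<^bsub>X\<^esub> g x \<or> g x = y \<and> y \<sqsubseteq>\<^bsub>X\<^esub> f x" using ex(2)[OF y] by blast
        then have "x \<in> ?S" "f x \<sqinter>\<^bsub>X\<^esub> g x = y" using f[of x] anti by (auto simp: mt)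
        then show "y \<in> (\<lambda>x\<in>?S. f x \<sqinter>\<^bsub>X\<^esub> g x) ` ?S"
          by (intro image_eqI[of _ _ x]) simp_all
      qed
      show "(\<lambda>x\<in>?S. f x \<sqinter>\<^bsub>X\<^esub> g x) ` ?S \<subseteq> ?S"
        using f by (intro image_subsetI) (simp add: mt)
    qed
    moreover have "f x \<sqinter>\<^bsub>X\<^esub> g x \<sqsubseteq>\<^bsub>X\<^esub> f y \<sqinter>\<^bsub>X\<^esub> g y \<longleftrightarrow> x \<sqsubseteq>\<^bsub>X\<^esub> y" if xy: "x \<in> ?S" "y \<in> ?S" for x y
    proof -
      have up: "u \<sqinter>\<^bsub>X\<^esub> v \<sqsubseteq>\<^bsub>X\<^esub> u" "u \<sqinter>\<^bsub>X\<^esub> v \<sqsubseteq>\<^bsub>X\<^esub> v" "u \<sqinter>\<^bsub>X\<^esub> v \<in> ?S" "u \<sqinter>\<^bsub>X\<^esub> v = u \<or> u \<sqinter>\<^bsub>X\<^esub> v = v"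
        if "u \<in> ?S" "v \<in> ?S" for u v
        using that total_order_total[OF that] by (auto simp: mt)
      note fx = f[OF xy(1)] and fy = f[OF xy(2)]
      show ?thesis
      proof
        assume "x \<sqsubseteq>\<^bsub>X\<^esub> y"
        then have "f x \<sqsubseteq>\<^bsub>X\<^esub> f y" "g x \<sqsubseteq>\<^bsub>X\<^esub> g y" using mo[OF xy] by simp_all
        then have "f x \<sqinter>\<^bsub>X\<^esub> g x \<sqsubseteq>\<^bsub>X\<^esub> f y" "f x \<sqinter>\<^bsub>X\<^esub> g x \<sqsubseteq>\<^bsub>X\<^esub> g y"
          using le_trans[OF up(1)[OF fx]] le_trans[OF up(2)[OF fx]] fx fy up(3)[OF fx] by blast+
        then show "f x \<sqinter>\<^bsub>X\<^esub> g x \<sqsubseteq>\<^bsub>X\<^esub> f y \<sqinter>\<^bsub>X\<^esub> g y" using up(4)[OF fy] by auto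
      next
        assume "f x \<sqinter>\<^bsub>X\<^esub> g x \<sqsubseteq>\<^bsub>X\<^esub> f y \<sqinter>\<^bsub>X\<^esub> g y"
        then have "f x \<sqinter>\<^bsub>X\<^esub> g x \<sqsubseteq>\<^bsub>X\<^esub> f y" "f x \<sqinter>\<^bsub>X\<^esub> g x \<sqsubseteq>\<^bsub>X\<^esub> g y"
          using le_trans[OF _ up(1)[OF fy]] le_trans[OF _ up(2)[OF fy]] fx fy up(3)[OF fx] up(3)[OF fy] by blast+
        then show "x \<sqsubseteq>\<^bsub>X\<^esub> y" using up(4)[OF fx] mo[OF xy] by auto
      qed
    qed
    ultimately show "(\<lambda>x\<in>?S. f x \<sqinter>\<^bsub>X\<^esub> g x) \<in> carrier ?A" by (simp add: Aiff)
  qed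
  have cmp: "g x \<sqsubseteq>\<^bsub>X\<^esub> f x" if "f \<in> carrier ?A" "g \<in> carrier ?A" "x \<in> ?S" "\<not> f x \<sqsubseteq>\<^bsub>X\<^esub> g x" for f g x
    using total_order_total[OF in_S[OF that(1,3)] in_S[OF that(2,3)]] that(4) by simp
  have j: "least (ord_of ?A) (\<lambda>x\<in>?S. f x \<squnion>\<^bsub>X\<^esub> g x) (Upper (ord_of ?A) {f, g})"
    if fg: "f \<in> carrier ?A" "g \<in> carrier ?A" for f g
    using closed[OF fg] fg in_S cmp[OF fg]
    by (subst least_Upper_pair) (auto simp: jn)
  have m: "greatest (ord_of ?A) (\<lambda>x\<in>?S. f x \<sqinter>\<^bsub>X\<^esub> g x) (Lower (ord_of ?A) {f, g})"
    if fg: "f \<in> carrier ?A" "g \<in> carrier ?A" for f g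
    using closed[OF fg] fg in_S cmp[OF fg]
    by (subst greatest_Lower_pair) (auto simp: mt)
  show "l_group ?A"
  proof (intro l_group.intro po_group.intro po_group_axioms.intro l_group_axioms.intro)
    show "lattice (ord_of ?A)" unfolding lattice_iff ord_of_simps using poA j m by blast
    fix a b s t
    assume "a \<preceq>\<^bsub>?A\<^esub> b" and "a \<in> carrier ?A" "b \<in> carrier ?A" "s \<in> carrier ?A" "t \<in> carrier ?A"
    then show "s \<otimes>\<^bsub>?A\<^esub> a \<otimes>\<^bsub>?A\<^esub> t \<preceq>\<^bsub>?A\<^esub> s \<otimes>\<^bsub>?A\<^esub> b \<otimes>\<^bsub>?A\<^esub> t"
      using in_S by (auto simp: compose_eq) (auto simp: Aiff)
  qed (fact grA poA)+
  show "\<lbrakk>f \<in> carrier ?A; g \<in> carrier ?A\<rbrakk> \<Longrightarrow> f \<squnion>\<^bsub>ord_of ?A\<^esub> g = (\<lambda>x\<in>?S. f x \<squnion>\<^bsub>X\<^esub> g x)"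
    using join_eqI[OF poA j] .
  show "\<lbrakk>f \<in> carrier ?A; g \<in> carrier ?A\<rbrakk> \<Longrightarrow> f \<sqinter>\<^bsub>ord_of ?A\<^esub> g = (\<lambda>x\<in>?S. f x \<sqinter>\<^bsub>X\<^esub> g x)"
    using meet_eqI[OF poA m] .
qed

lemma Omega_simps [simp]:
  "carrier (Omega G r) = carrier G // (r \<inter> r\<inverse>)"
  "eq (Omega G r) = (=)"
  "X \<sqsubseteq>\<^bsub>Omega G r\<^esub> Y \<longleftrightarrow> (\<exists>a\<in>X. \<exists>b\<in>Y. (a, b) \<in> r)"
  by (simp_all add: Omega_def)

lemma right_preorder_equiv:
  assumes "right_preorder G r"
  shows "equiv (carrier G) (r \<inter> r\<inverse>)"
proof (rule equivI)
  have r: "r \<subseteq> carrier G \<times> carrier G" "refl_on (carrier G) r" "trans r"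
    using assms by (simp_all add: right_preorder_def preorder_on_def)
  show "r \<inter> r\<inverse> \<subseteq> carrier G \<times> carrier G" using r(1) by blast
  show "refl_on (carrier G) (r \<inter> r\<inverse>)" using r(2) by (simp add: refl_on_def)
  show "sym (r \<inter> r\<inverse>)" by (rule sym_Int_converse)
  show "trans (r \<inter> r\<inverse>)" using r(3) by (intro trans_Int) simp_all
qed

lemma Omega_class_le_iff:
  assumes "right_preorder G r" "a \<in> carrier G" "b \<in> carrier G"
  shows "(r \<inter> r\<inverse>) `` {a} \<sqsubseteq>\<^bsub>Omega G r\<^esub> (r \<inter> r\<inverse>) `` {b} \<longleftrightarrow> (a, b) \<in> r"
proof -
  have "trans r" "(a, a) \<in> r" "(b, b) \<in> r"
    using assms by (auto simp: right_preorder_def preorder_on_def refl_on_def)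
  then show ?thesis by (auto dest: transD)
qed

lemma Omega_total_order:
  assumes "right_preorder G r"
  shows "total_order (Omega G r)"
proof -
  let ?E = "r \<inter> r\<inverse>"
  note eq = right_preorder_equiv[OF assms] and le = Omega_class_le_iff[OF assms]
  have tr: "trans r" and rf: "\<And>a. a \<in> carrier G \<Longrightarrow> (a, a) \<in> r"
    and to: "\<And>a b. a \<in> carrier G \<Longrightarrow> b \<in> carrier G \<Longrightarrow> (a, b) \<in> r \<or> (b, a) \<in> r"
    using assms by (auto simp: right_preorder_def preorder_on_def refl_on_def total_on_def) metis
  have rep: "\<exists>a\<in>carrier G. X = ?E `` {a}" if "X \<in> carrier G // ?E" for X
    using that by (auto simp: quotient_def)
  have "partial_order (Omega G r)"
  proof (subst partial_order_iff, simp, intro conjI ballI impI)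
    fix X assume "X \<in> carrier (Omega G r)"
    then show "X \<sqsubseteq>\<^bsub>Omega G r\<^esub> X" using rep le rf by (metis Omega_simps(1))
  next
    fix X Y assume "X \<in> carrier (Omega G r)" "Y \<in> carrier (Omega G r)"
      and h: "X \<sqsubseteq>\<^bsub>Omega G r\<^esub> Y \<and> Y \<sqsubseteq>\<^bsub>Omega G r\<^esub> X"
    then obtain a b where ab: "a \<in> carrier G" "b \<in> carrier G" "X = ?E `` {a}" "Y = ?E `` {b}"
      using rep by (metis Omega_simps(1))
    then have "(a, b) \<in> ?E" using h le by blast
    then show "X = Y" using ab equiv_class_eq[OF eq] by simp
  next
    fix X Y Z assume "X \<in> carrier (Omega G r)" "Y \<in> carrier (Omega G r)" "Z \<in> carrier (Omega G r)"
      and h: "X \<sqsubseteq>\<^bsub>Omega G r\<^esub> Y \<and> Y \<sqsubseteq>\<^bsub>Omega G r\<^esub> Z"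
    then obtain a b c where ab: "a \<in> carrier G" "b \<in> carrier G" "c \<in> carrier G"
       "X = ?E `` {a}" "Y = ?E `` {b}" "Z = ?E `` {c}"
      using rep by (metis Omega_simps(1))
    then show "X \<sqsubseteq>\<^bsub>Omega G r\<^esub> Z" using h le tr by (metis transD)
  qed
  then show ?thesis
  proof (rule partial_order.total_orderI)
    fix X Y assume "X \<in> carrier (Omega G r)" "Y \<in> carrier (Omega G r)"
    then obtain a b where "a \<in> carrier G" "b \<in> carrier G" "X = ?E `` {a}" "Y = ?E `` {b}"
      using rep by (metis Omega_simps(1))
    then show "X \<sqsubseteq>\<^bsub>Omega G r\<^esub> Y \<or> Y \<sqsubseteq>\<^bsub>Omega G r\<^esub> X" using le to by metis
  qed
qed

lemma right_reg_class:
  assumes "po_group G" "right_preorder G r" "a \<in> carrier G" "b \<in> carrier G"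
  shows "right_reg G r a ((r \<inter> r\<inverse>) `` {b}) = (r \<inter> r\<inverse>) `` {b \<otimes>\<^bsub>G\<^esub> a}"
proof -
  let ?E = "r \<inter> r\<inverse>"
  note eq = right_preorder_equiv[OF assms(2)]
  have "?E `` {c \<otimes>\<^bsub>G\<^esub> a} = ?E `` {b \<otimes>\<^bsub>G\<^esub> a}" if "c \<in> ?E `` {b}" for c
    using that assms(2,3) by (intro equiv_class_eq[OF eq]) (auto simp: right_preorder_def)
  moreover have "b \<in> ?E `` {b}" using equiv_class_self[OF eq assms(4)] .
  ultimately have "(\<Union>c\<in>?E `` {b}. ?E `` {c \<otimes>\<^bsub>G\<^esub> a}) = ?E `` {b \<otimes>\<^bsub>G\<^esub> a}" by blast
  moreover have "?E `` {b} \<in> carrier G // ?E" using assms(4) by (rule quotientI)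
  ultimately show ?thesis by (simp add: right_reg_def)
qed

lemma right_reg_Aut:
  assumes G: "po_group G" and r: "right_preorder G r" and a: "a \<in> carrier G"
  shows "right_reg G r a \<in> carrier (Aut (Omega G r))"
proof -
  interpret po_group G by (rule G)
  let ?E = "r \<inter> r\<inverse>" and ?S = "carrier G // (r \<inter> r\<inverse>)"
  note rr = right_reg_class[OF G r] and le = Omega_class_le_iff[OF r]
  have rep: "\<exists>a\<in>carrier G. X = ?E `` {a}" if "X \<in> ?S" for X
    using that by (auto simp: quotient_def)
  have "right_reg G r a ` ?S = ?S"
  proof
    show "right_reg G r a ` ?S \<subseteq> ?S" 
    proof (intro image_subsetI)
      fix X assume "X \<in> ?S"
      then obtain b where "b \<in> carrier G" "X = ?E `` {b}" using rep by blast
      then show "right_reg G r a X \<in> ?S" using rr[OF a] quotientI[of "b \<otimes>\<^bsub>G\<^esub> a"] a by simp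
    qed
    show "?S \<subseteq> right_reg G r a ` ?S"
    proof
      fix X assume "X \<in> ?S"
      then obtain b where b: "b \<in> carrier G" "X = ?E `` {b}" using rep by blast
      have "b \<otimes>\<^bsub>G\<^esub> inv\<^bsub>G\<^esub> a \<otimes>\<^bsub>G\<^esub> a = b" using a b(1) by (simp add: m_assoc)
      moreover have "b \<otimes>\<^bsub>G\<^esub> inv\<^bsub>G\<^esub> a \<in> carrier G" using a b(1) by simp
      ultimately have "right_reg G r a (?E `` {b \<otimes>\<^bsub>G\<^esub> inv\<^bsub>G\<^esub> a}) = X"
        using rr[OF a, of "b \<otimes>\<^bsub>G\<^esub> inv\<^bsub>G\<^esub> a"] b(2) by (simp only:)
      moreover have "?E `` {b \<otimes>\<^bsub>G\<^esub> inv\<^bsub>G\<^esub> a} \<in> ?S" using a b by (intro quotientI) simp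
      ultimately show "X \<in> right_reg G r a ` ?S" by (intro image_eqI[OF sym])
    qed
  qed
  moreover have "right_reg G r a X \<sqsubseteq>\<^bsub>Omega G r\<^esub> right_reg G r a Y \<longleftrightarrow> X \<sqsubseteq>\<^bsub>Omega G r\<^esub> Y"
    if XY: "X \<in> ?S" "Y \<in> ?S" for X Y
  proof -
    obtain b c where bc: "b \<in> carrier G" "c \<in> carrier G" "X = ?E `` {b}" "Y = ?E `` {c}"
      using rep[OF XY(1)] rep[OF XY(2)] by blast
    have "(b \<otimes>\<^bsub>G\<^esub> a, c \<otimes>\<^bsub>G\<^esub> a) \<in> r \<longleftrightarrow> (b, c) \<in> r"
    proof
      assume "(b \<otimes>\<^bsub>G\<^esub> a, c \<otimes>\<^bsub>G\<^esub> a) \<in> r"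
      then have "(b \<otimes>\<^bsub>G\<^esub> a \<otimes>\<^bsub>G\<^esub> inv\<^bsub>G\<^esub> a, c \<otimes>\<^bsub>G\<^esub> a \<otimes>\<^bsub>G\<^esub> inv\<^bsub>G\<^esub> a) \<in> r" using r a by (auto simp: right_preorder_def)
      then show "(b, c) \<in> r" using a bc by (simp add: m_assoc)
    qed (use r a in \<open>auto simp: right_preorder_def\<close>)
    then show ?thesis using bc a rr le m_closed by metis
  qed
  ultimately show ?thesis
    unfolding carrier_Aut_iff[OF Omega_total_order[OF r]]
    by (auto simp: right_reg_def simp del: Omega_simps(3))
qed

lemma H_of_l_group:
  assumes "po_group G" "right_preorder G r"
  shows "l_group (H_of G r)"
  unfolding H_of_def
  by (intro l_subgroup_l_group(1) l_generate_l_subgroup Aut_l_group Omega_total_order)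
    (use assms right_reg_Aut in auto)

lemma totally_ordered_join_meet:
  assumes "totally_ordered_group A" "x \<in> carrier A" "y \<in> carrier A"
  shows "x \<squnion>\<^bsub>ord_of A\<^esub> y = (if x \<preceq>\<^bsub>A\<^esub> y then y else x)"
    and "x \<sqinter>\<^bsub>ord_of A\<^esub> y = (if x \<preceq>\<^bsub>A\<^esub> y then x else y)"
proof -
  interpret total_order "ord_of A" using assms(1) by (rule totally_ordered_group.tot)
  have "x \<preceq>\<^bsub>A\<^esub> x" "y \<preceq>\<^bsub>A\<^esub> y" "x \<preceq>\<^bsub>A\<^esub> y \<or> y \<preceq>\<^bsub>A\<^esub> x"
    using assms le_refl total_order_total by simp_all
  then have "least (ord_of A) (if x \<preceq>\<^bsub>A\<^esub> y then y else x) (Upper (ord_of A) {x, y})"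
    "greatest (ord_of A) (if x \<preceq>\<^bsub>A\<^esub> y then x else y) (Lower (ord_of A) {x, y})"
    using assms by (auto simp: least_Upper_pair greatest_Lower_pair)
  then show "x \<squnion>\<^bsub>ord_of A\<^esub> y = (if x \<preceq>\<^bsub>A\<^esub> y then y else x)"
     "x \<sqinter>\<^bsub>ord_of A\<^esub> y = (if x \<preceq>\<^bsub>A\<^esub> y then x else y)"
    using join_eqI[OF partial_order_axioms] meet_eqI[OF partial_order_axioms] by metis+
qed

lemma totally_ordered_transport:
  fixes A :: "('b, 'n) pogroup_scheme" and r :: "'b \<Rightarrow> 'a"
  assumes A: "totally_ordered_group A" and pr: "\<And>y. y \<in> carrier A \<Longrightarrow> p (r y) = y"
  defines "T \<equiv> \<lparr>carrier = r ` carrier A, mult = (\<lambda>u v. r (p u \<otimes>\<^bsub>A\<^esub> p v)), one = r \<one>\<^bsub>A\<^esub>,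
    leq = (\<lambda>u v. p u \<preceq>\<^bsub>A\<^esub> p v)\<rparr>"
  shows "totally_ordered_group T"
proof -
  interpret totally_ordered_group A by fact
  have po: "\<forall>x\<in>carrier A. x \<preceq>\<^bsub>A\<^esub> x"
     "\<forall>x\<in>carrier A. \<forall>y\<in>carrier A. x \<preceq>\<^bsub>A\<^esub> y \<and> y \<preceq>\<^bsub>A\<^esub> x \<longrightarrow> x = y"
     "\<forall>x\<in>carrier A. \<forall>y\<in>carrier A. \<forall>z\<in>carrier A. x \<preceq>\<^bsub>A\<^esub> y \<and> y \<preceq>\<^bsub>A\<^esub> z \<longrightarrow> x \<preceq>\<^bsub>A\<^esub> z"
    using ord unfolding partial_order_iff[of "ord_of A", simplified] by blast+
  have poT: "partial_order (ord_of T)"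
    unfolding partial_order_iff[of "ord_of T", simplified]
  proof (intro conjI)
    show "\<forall>x\<in>carrier T. x \<preceq>\<^bsub>T\<^esub> x" using po(1) by (simp add: T_def pr)
    show "\<forall>x\<in>carrier T. \<forall>y\<in>carrier T. x \<preceq>\<^bsub>T\<^esub> y \<and> y \<preceq>\<^bsub>T\<^esub> x \<longrightarrow> x = y"
      using po(2) by (simp add: T_def pr) blast
    show "\<forall>x\<in>carrier T. \<forall>y\<in>carrier T. \<forall>z\<in>carrier T. x \<preceq>\<^bsub>T\<^esub> y \<and> y \<preceq>\<^bsub>T\<^esub> z \<longrightarrow> x \<preceq>\<^bsub>T\<^esub> z"
      by (simp add: T_def pr) (use po(3) in blast)
  qed
  show ?thesis
  proof (intro totally_ordered_group.intro po_group.intro po_group_axioms.intro totally_ordered_group_axioms.intro)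
    show "group T"
    proof (rule groupI)
      show "\<exists>y\<in>carrier T. y \<otimes>\<^bsub>T\<^esub> x = \<one>\<^bsub>T\<^esub>" if "x \<in> carrier T" for x
      proof -
        obtain z where z: "z \<in> carrier A" "x = r z" using \<open>x \<in> carrier T\<close> by (auto simp: T_def)
        then have "r (inv\<^bsub>A\<^esub> z) \<in> carrier T" "r (inv\<^bsub>A\<^esub> z) \<otimes>\<^bsub>T\<^esub> x = \<one>\<^bsub>T\<^esub>"
          by (auto simp: T_def pr)
        then show ?thesis by blast
      qed
    qed (auto simp: T_def pr m_assoc)
    show "partial_order (ord_of T)" by (rule poT)
    show "s \<otimes>\<^bsub>T\<^esub> a \<otimes>\<^bsub>T\<^esub> t \<preceq>\<^bsub>T\<^esub> s \<otimes>\<^bsub>T\<^esub> b \<otimes>\<^bsub>T\<^esub> t"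
      if "a \<preceq>\<^bsub>T\<^esub> b" "a \<in> carrier T" "b \<in> carrier T" "s \<in> carrier T" "t \<in> carrier T" for a b s t
      using that leq_translate[of "p a" "p b" "p s" "p t"] by (auto simp: T_def pr)
    show "total_order (ord_of T)"
      using poT
    proof (rule partial_order.total_orderI)
      show "x \<sqsubseteq>\<^bsub>ord_of T\<^esub> y \<or> y \<sqsubseteq>\<^bsub>ord_of T\<^esub> x"
        if "x \<in> carrier (ord_of T)" "y \<in> carrier (ord_of T)" for x y
        using that total_order.total_order_total[OF tot, of "p x" "p y"] by (auto simp: T_def pr)
    qed
  qed
qed

lemma representableI:
  fixes H :: "('a, 'm) pogroup_scheme" and F :: "'i \<Rightarrow> ('b, 'n) pogroup_scheme"
  assumes H: "l_group H" and F: "\<And>i. i \<in> I \<Longrightarrow> totally_ordered_group (F i)"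
    and h: "subdirect_embedding H I F h"
  shows "representable H"
proof -
  interpret H: l_group H by fact
  let ?P = "product_pogroup I F"
  have lF: "l_group (F i)" if "i \<in> I" for i
  proof -
    interpret totally_ordered_group "F i" using F[OF that] .
    show ?thesis by (rule l_group_axioms)
  qed
  have lP: "l_group ?P" using lF by (rule product_l_group(1))
  note jP = product_l_group(2)[OF lF, simplified] and mP = product_l_group(3)[OF lF, simplified]
  have hom: "h \<in> hom H ?P" and inj: "inj_on h (carrier H)"
    and surj: "\<And>i. i \<in> I \<Longrightarrow> (\<lambda>x. h x i) ` carrier H = carrier (F i)"
    and hj: "\<And>x y. x \<in> carrier H \<Longrightarrow> y \<in> carrier H \<Longrightarrow>
      h (x \<squnion>\<^bsub>ord_of H\<^esub> y) = h x \<squnion>\<^bsub>ord_of ?P\<^esub> h y"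
    and hm: "\<And>x y. x \<in> carrier H \<Longrightarrow> y \<in> carrier H \<Longrightarrow>
      h (x \<sqinter>\<^bsub>ord_of H\<^esub> y) = h x \<sqinter>\<^bsub>ord_of ?P\<^esub> h y"
    using h by (simp_all add: subdirect_embedding_def l_hom_def join_pres_def meet_pres_def)
  have hc: "h x \<in> (\<Pi>\<^sub>E i\<in>I. carrier (F i))" if "x \<in> carrier H" for x
    using hom_in_carrier[OF hom that] by simp
  have hi: "h x i \<in> carrier (F i)" if "x \<in> carrier H" "i \<in> I" for x i
    using hc[OF that(1)] that(2) by (rule PiE_mem)
  have hmult: "h (x \<otimes>\<^bsub>H\<^esub> y) i = h x i \<otimes>\<^bsub>F i\<^esub> h y i"
    if "x \<in> carrier H" "y \<in> carrier H" "i \<in> I" for x y i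
    using hom_mult[OF hom that(1,2)] that(3) by simp
  have hjoin: "h (x \<squnion>\<^bsub>ord_of H\<^esub> y) i = h x i \<squnion>\<^bsub>ord_of (F i)\<^esub> h y i"
    and hmeet: "h (x \<sqinter>\<^bsub>ord_of H\<^esub> y) i = h x i \<sqinter>\<^bsub>ord_of (F i)\<^esub> h y i"
    if "x \<in> carrier H" "y \<in> carrier H" "i \<in> I" for x y i
    using that hc by (simp_all add: hj hm jP mP)
  have gP: "group ?P" using lP by (simp add: l_group_def po_group_def)
  have hone: "h \<one>\<^bsub>H\<^esub> = \<one>\<^bsub>?P\<^esub>" using hom_one[OF hom H.is_group gP] .

  define J where "J = {x \<in> carrier H. x \<noteq> \<one>\<^bsub>H\<^esub>}"
  have "\<exists>i\<in>I. h x i \<noteq> \<one>\<^bsub>F i\<^esub>" if x: "x \<in> J" for x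
  proof (rule ccontr)
    assume c: "\<not> ?thesis"
    have xc: "x \<in> carrier H" and x1: "x \<noteq> \<one>\<^bsub>H\<^esub>" using x by (simp_all add: J_def)
    have "h x = h \<one>\<^bsub>H\<^esub>"
      using c hone by (intro PiE_ext[OF hc[OF xc] hc[OF H.one_closed]]) simp
    then have "x = \<one>\<^bsub>H\<^esub>" using inj_onD[OF inj _ xc H.one_closed] by blast
    then show False using x1 by simp
  qed
  then obtain k where k: "\<And>x. x \<in> J \<Longrightarrow> k x \<in> I \<and> h x (k x) \<noteq> \<one>\<^bsub>F (k x)\<^esub>" by metis
  define p where "p j x = h x (k j)" for j x
  define r where "r j = inv_into (carrier H) (p j)" for j
  define T :: "'a \<Rightarrow> 'a pogroup" where
    "T j = \<lparr>carrier = r j ` carrier (F (k j)),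
       mult = (\<lambda>u v. r j (p j u \<otimes>\<^bsub>F (k j)\<^esub> p j v)), one = r j \<one>\<^bsub>F (k j)\<^esub>,
       leq = (\<lambda>u v. p j u \<preceq>\<^bsub>F (k j)\<^esub> p j v)\<rparr>" for j
  have pr: "p j (r j y) = y" if "j \<in> J" "y \<in> carrier (F (k j))" for j y
    unfolding r_def using that surj[of "k j"] k[of j] by (intro f_inv_into_f) (simp add: p_def)
  have T: "totally_ordered_group (T j)" if "j \<in> J" for j
    unfolding T_def using F k that pr by (intro totally_ordered_transport) blast+
  have lT: "l_group (T j)" if "j \<in> J" for j
  proof -
    interpret totally_ordered_group "T j" using T[OF that] .
    show ?thesis by (rule l_group_axioms)
  qed
  have rT: "r j y \<in> carrier (T j)" if "y \<in> carrier (F (k j))" for j y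
    using that by (simp add: T_def)
  have rjoin: "r j y \<squnion>\<^bsub>ord_of (T j)\<^esub> r j z = r j (y \<squnion>\<^bsub>ord_of (F (k j))\<^esub> z)"
    and rmeet: "r j y \<sqinter>\<^bsub>ord_of (T j)\<^esub> r j z = r j (y \<sqinter>\<^bsub>ord_of (F (k j))\<^esub> z)"
    if j: "j \<in> J" and yz: "y \<in> carrier (F (k j))" "z \<in> carrier (F (k j))" for j y z
  proof -
    have "r j y \<preceq>\<^bsub>T j\<^esub> r j z \<longleftrightarrow> y \<preceq>\<^bsub>F (k j)\<^esub> z" using pr j yz by (simp add: T_def)
    moreover have "totally_ordered_group (F (k j))" using F k[OF j] by blast
    ultimately show "r j y \<squnion>\<^bsub>ord_of (T j)\<^esub> r j z = r j (y \<squnion>\<^bsub>ord_of (F (k j))\<^esub> z)"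
      "r j y \<sqinter>\<^bsub>ord_of (T j)\<^esub> r j z = r j (y \<sqinter>\<^bsub>ord_of (F (k j))\<^esub> z)"
      using yz rT[of y j] rT[of z j] T[OF j] by (simp_all add: totally_ordered_join_meet)
  qed
  let ?Q = "product_pogroup J T"
  have lQ: "l_group ?Q" using lT by (rule product_l_group(1))
  define g where "g x = (\<lambda>j\<in>J. r j (p j x))" for x
  have pc: "p j x \<in> carrier (F (k j))" if "x \<in> carrier H" "j \<in> J" for x j
    using that hi k by (simp add: p_def)
  have gc: "g x \<in> (\<Pi>\<^sub>E j\<in>J. carrier (T j))" if "x \<in> carrier H" for x
    using that pc rT by (simp add: g_def)
  have "g \<in> hom H ?Q"
  proof (rule homI)
    show "g x \<in> carrier ?Q" if "x \<in> carrier H" for x using gc[OF that] by simp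
    show "g (x \<otimes>\<^bsub>H\<^esub> y) = g x \<otimes>\<^bsub>?Q\<^esub> g y" if xy: "x \<in> carrier H" "y \<in> carrier H" for x y
    proof -
      have "r j (p j (x \<otimes>\<^bsub>H\<^esub> y)) = r j (p j x) \<otimes>\<^bsub>T j\<^esub> r j (p j y)" if j: "j \<in> J" for j
        using hmult[OF xy, of "k j"] k[OF j] pr[OF j] pc[OF _ j] xy by (simp add: T_def p_def)
      then show ?thesis by (simp add: g_def cong: restrict_cong)
    qed
  qed
  moreover have "g (x \<squnion>\<^bsub>ord_of H\<^esub> y) = g x \<squnion>\<^bsub>ord_of ?Q\<^esub> g y"
      "g (x \<sqinter>\<^bsub>ord_of H\<^esub> y) = g x \<sqinter>\<^bsub>ord_of ?Q\<^esub> g y"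
    if xy: "x \<in> carrier H" "y \<in> carrier H" for x y
  proof -
    have "r j (p j (x \<squnion>\<^bsub>ord_of H\<^esub> y)) = r j (p j x) \<squnion>\<^bsub>ord_of (T j)\<^esub> r j (p j y)"
      "r j (p j (x \<sqinter>\<^bsub>ord_of H\<^esub> y)) = r j (p j x) \<sqinter>\<^bsub>ord_of (T j)\<^esub> r j (p j y)" if j: "j \<in> J" for j
      using hjoin[OF xy, of "k j"] hmeet[OF xy, of "k j"] k[OF j] pc[OF xy(1) j] pc[OF xy(2) j]
        rjoin[OF j] rmeet[OF j] by (simp_all add: p_def)
    moreover have "g x \<squnion>\<^bsub>ord_of ?Q\<^esub> g y = (\<lambda>j\<in>J. g x j \<squnion>\<^bsub>ord_of (T j)\<^esub> g y j)"
      "g x \<sqinter>\<^bsub>ord_of ?Q\<^esub> g y = (\<lambda>j\<in>J. g x j \<sqinter>\<^bsub>ord_of (T j)\<^esub> g y j)"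
      using gc[OF xy(1)] gc[OF xy(2)]
      by (simp_all add: product_l_group(2)[OF lT] product_l_group(3)[OF lT])
    ultimately show "g (x \<squnion>\<^bsub>ord_of H\<^esub> y) = g x \<squnion>\<^bsub>ord_of ?Q\<^esub> g y"
      "g (x \<sqinter>\<^bsub>ord_of H\<^esub> y) = g x \<sqinter>\<^bsub>ord_of ?Q\<^esub> g y"
      by (simp_all add: g_def cong: restrict_cong)
  qed
  ultimately have "g \<in> l_hom H ?Q"
    using H.lat l_group.lat[OF lQ] by (simp add: l_hom_def join_pres_def meet_pres_def)
  moreover have "inj_on g (carrier H)"
  proof (rule inj_onI, rule ccontr)
    fix x y assume xy: "x \<in> carrier H" "y \<in> carrier H" "g x = g y" "x \<noteq> y"
    let ?z = "x \<otimes>\<^bsub>H\<^esub> inv\<^bsub>H\<^esub> y"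
    have z: "?z \<in> carrier H" using xy by simp
    have zy: "?z \<otimes>\<^bsub>H\<^esub> y = x" using xy by (simp add: H.m_assoc)
    have "?z \<noteq> \<one>\<^bsub>H\<^esub>" using zy xy by force
    then have zJ: "?z \<in> J" using z by (simp add: J_def)
    have "r ?z (p ?z x) = r ?z (p ?z y)" using fun_cong[OF xy(3), of ?z] zJ by (simp add: g_def)
    then have "p ?z x = p ?z y" using pr[OF zJ] pc[OF _ zJ] xy by metis
    then have "h (?z \<otimes>\<^bsub>H\<^esub> y) (k ?z) = h y (k ?z)" by (simp only: zy p_def)
    then have e: "h ?z (k ?z) \<otimes>\<^bsub>F (k ?z)\<^esub> h y (k ?z) = h y (k ?z)"
      using hmult[OF z xy(2)] k[OF zJ] by simp
    interpret Fk: l_group "F (k ?z)" using lF k[OF zJ] by blast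
    have "h ?z (k ?z) \<in> carrier (F (k ?z))" "h y (k ?z) \<in> carrier (F (k ?z))"
      using hi z xy(2) k[OF zJ] by simp_all
    then have "h ?z (k ?z) = \<one>\<^bsub>F (k ?z)\<^esub>"
      using e Fk.r_cancel_one by blast
    then show False using k[OF zJ] by blast
  qed
  moreover have "(\<lambda>x. g x j) ` carrier H = carrier (T j)" if j: "j \<in> J" for j
  proof -
    have "(\<lambda>x. g x j) ` carrier H = r j ` ((\<lambda>x. h x (k j)) ` carrier H)"
      using j by (simp add: g_def p_def image_image)
    also have "\<dots> = carrier (T j)" using surj k[OF j] by (simp add: T_def)
    finally show ?thesis .
  qed
  ultimately have "subdirect_embedding H J T g" by (simp add: subdirect_embedding_def)
  then show ?thesis unfolding representable_def using H T by blast
qed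

text \<open>The pre-order is recovered from its pre-cone.\<close>

lemma right_preorder_iff_pre_cone:
  assumes "po_group G" "right_preorder G r" "a \<in> carrier G" "b \<in> carrier G"
  shows "(a, b) \<in> r \<longleftrightarrow> b \<otimes>\<^bsub>G\<^esub> inv\<^bsub>G\<^esub> a \<in> pre_cone G r"
proof -
  interpret po_group G by fact
  have tr: "(x \<otimes>\<^bsub>G\<^esub> t, y \<otimes>\<^bsub>G\<^esub> t) \<in> r" if "(x, y) \<in> r" "t \<in> carrier G" for x y t
    using assms(2) that by (simp add: right_preorder_def)
  show ?thesis
    using tr[of a b "inv\<^bsub>G\<^esub> a"] tr[of "\<one>\<^bsub>G\<^esub>" "b \<otimes>\<^bsub>G\<^esub> inv\<^bsub>G\<^esub> a" a] assms(3,4)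
    by (auto simp: pre_cone_def m_assoc)
qed

end

(*
  Condition (3) says that every right translation R(a) is comparable with the identity. Then R[G] is
  a chain in Aut(Omega), so it is closed under joins and meets and H_C = R[G] is totally ordered.
  Conversely, representable l-groups satisfy the identity (x v 1) ^ (y^-1 (x^-1 v 1) y) = 1, because
  totally ordered groups do. If R(a) moves [c] up and [b] down, the identity fails at the
  point [c] for x = R(a) and y = R(b^-1 c), which maps [b] to [c].
*)
theory Submission
  imports Defs
begin

section \<open>Joins, meets and an identity of representable l-groups\<close>

text \<open>Comparability is asked of the one pair only, so this applies inside
  \<open>Aut (Omega G r)\<close>, whose order is in general only partial.\<close>

lemma comparable_join_meet:
  assumes "partial_order L" and xy: "x \<in> carrier L" "y \<in> carrier L"
    and "x \<sqsubseteq>\<^bsub>L\<^esub> y \<or> y \<sqsubseteq>\<^bsub>L\<^esub> x"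
  shows "x \<squnion>\<^bsub>L\<^esub> y = (if x \<sqsubseteq>\<^bsub>L\<^esub> y then y else x)"
    and "x \<sqinter>\<^bsub>L\<^esub> y = (if x \<sqsubseteq>\<^bsub>L\<^esub> y then x else y)"
proof -
  interpret partial_order L by fact
  have "least L (if x \<sqsubseteq>\<^bsub>L\<^esub> y then y else x) (Upper L {x, y})"
    "greatest L (if x \<sqsubseteq>\<^bsub>L\<^esub> y then x else y) (Lower L {x, y})"
    using assms by (auto simp: least_Upper_pair[OF xy] greatest_Lower_pair[OF xy])
  then show "x \<squnion>\<^bsub>L\<^esub> y = (if x \<sqsubseteq>\<^bsub>L\<^esub> y then y else x)"
    "x \<sqinter>\<^bsub>L\<^esub> y = (if x \<sqsubseteq>\<^bsub>L\<^esub> y then x else y)"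
    using join_eqI[OF partial_order_axioms] meet_eqI[OF partial_order_axioms] by metis+
qed

text \<open>One of x and x^-1 is at most the identity, so one of the two joins is the identity.
  Conjugation fixes the identity and preserves positivity, so the meet pairs the identity with an
  element above it.\<close>

lemma totally_ordered_group_conj_identity:
  assumes "totally_ordered_group A" and x: "x \<in> carrier A" and y: "y \<in> carrier A"
  shows "(x \<squnion>\<^bsub>ord_of A\<^esub> \<one>\<^bsub>A\<^esub>) \<sqinter>\<^bsub>ord_of A\<^esub>
    (inv\<^bsub>A\<^esub> y \<otimes>\<^bsub>A\<^esub> (inv\<^bsub>A\<^esub> x \<squnion>\<^bsub>ord_of A\<^esub> \<one>\<^bsub>A\<^esub>) \<otimes>\<^bsub>A\<^esub> y) = \<one>\<^bsub>A\<^esub>"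
proof -
  interpret totally_ordered_group A by fact
  note jm = totally_ordered_join_meet[OF assms(1)]
  have anti: "u = v" if "u \<preceq>\<^bsub>A\<^esub> v" "v \<preceq>\<^bsub>A\<^esub> u" "u \<in> carrier A" "v \<in> carrier A" for u v
    using ord that unfolding partial_order_iff[of "ord_of A", simplified] by blast
  show ?thesis
  proof (cases "x \<preceq>\<^bsub>A\<^esub> \<one>\<^bsub>A\<^esub>")
    case True
    have "\<one>\<^bsub>A\<^esub> \<preceq>\<^bsub>A\<^esub> inv\<^bsub>A\<^esub> x"
      using leq_translate[OF True x one_closed one_closed inv_closed[OF x]] x by simp
    \<comment> \<open>If x^-1 lies below the identity as well, antisymmetry makes the two equal, so
      both branches of the join formula give x^-1.\<close>
    then have "inv\<^bsub>A\<^esub> x \<squnion>\<^bsub>ord_of A\<^esub> \<one>\<^bsub>A\<^esub> = inv\<^bsub>A\<^esub> x"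
      using jm(1)[OF inv_closed[OF x] one_closed] x by (auto dest: anti)
    moreover have "\<one>\<^bsub>A\<^esub> \<preceq>\<^bsub>A\<^esub> inv\<^bsub>A\<^esub> y \<otimes>\<^bsub>A\<^esub> inv\<^bsub>A\<^esub> x \<otimes>\<^bsub>A\<^esub> y"
      using leq_translate[OF \<open>\<one>\<^bsub>A\<^esub> \<preceq>\<^bsub>A\<^esub> inv\<^bsub>A\<^esub> x\<close> one_closed inv_closed[OF x] inv_closed[OF y] y] y
      by simp
    moreover have "x \<squnion>\<^bsub>ord_of A\<^esub> \<one>\<^bsub>A\<^esub> = \<one>\<^bsub>A\<^esub>"
      using jm(1)[OF x one_closed] True by simp
    ultimately show ?thesis
      using jm(2)[OF one_closed, of "inv\<^bsub>A\<^esub> y \<otimes>\<^bsub>A\<^esub> inv\<^bsub>A\<^esub> x \<otimes>\<^bsub>A\<^esub> y"] x y by simp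
  next
    case False
    then have le: "\<one>\<^bsub>A\<^esub> \<preceq>\<^bsub>A\<^esub> x" using total_order.total_order_total[OF tot, of x "\<one>\<^bsub>A\<^esub>"] x by simp
    have "inv\<^bsub>A\<^esub> x \<preceq>\<^bsub>A\<^esub> \<one>\<^bsub>A\<^esub>"
      using leq_translate[OF le one_closed x one_closed inv_closed[OF x]] x by simp
    then have "inv\<^bsub>A\<^esub> x \<squnion>\<^bsub>ord_of A\<^esub> \<one>\<^bsub>A\<^esub> = \<one>\<^bsub>A\<^esub>"
      using jm(1)[OF inv_closed[OF x] one_closed] by simp
    moreover have "x \<squnion>\<^bsub>ord_of A\<^esub> \<one>\<^bsub>A\<^esub> = x"
      using jm(1)[OF x one_closed] False by simp
    ultimately show ?thesis
      using jm(2)[OF x one_closed] False y by simp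
  qed
qed

text \<open>Each coordinate of a subdirect embedding is an l-homomorphism into a totally ordered
  group, where the identity holds. So the images of both sides agree in every coordinate, and
  injectivity of the embedding finishes.\<close>

lemma representable_conj_identity:
  fixes H :: "('a, 'm) pogroup_scheme"
  assumes "representable H" and x: "x \<in> carrier H" and y: "y \<in> carrier H"
  shows "(x \<squnion>\<^bsub>ord_of H\<^esub> \<one>\<^bsub>H\<^esub>) \<sqinter>\<^bsub>ord_of H\<^esub>
    (inv\<^bsub>H\<^esub> y \<otimes>\<^bsub>H\<^esub> (inv\<^bsub>H\<^esub> x \<squnion>\<^bsub>ord_of H\<^esub> \<one>\<^bsub>H\<^esub>) \<otimes>\<^bsub>H\<^esub> y) = \<one>\<^bsub>H\<^esub>"
    (is "?u = _")
proof -
  interpret H: l_group H using assms(1) by (simp add: representable_def)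
  obtain I :: "'a set" and F :: "'a \<Rightarrow> 'a pogroup" and h
    where F: "\<And>i. i \<in> I \<Longrightarrow> totally_ordered_group (F i)" and emb: "subdirect_embedding H I F h"
    using assms(1) by (auto simp: representable_def)
  let ?P = "product_pogroup I F"
  have lF: "l_group (F i)" if "i \<in> I" for i
  proof -
    interpret totally_ordered_group "F i" by (rule F[OF that])
    show ?thesis by (rule l_group_axioms)
  qed
  note P = product_l_group[of I F, OF lF]
  interpret P: l_group ?P by (rule P(1))
  have hom: "h \<in> hom H ?P" and inj: "inj_on h (carrier H)"
    and hj: "\<And>x y. \<lbrakk>x \<in> carrier H; y \<in> carrier H\<rbrakk> \<Longrightarrow>
      h (x \<squnion>\<^bsub>ord_of H\<^esub> y) = h x \<squnion>\<^bsub>ord_of ?P\<^esub> h y"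
    and hm: "\<And>x y. \<lbrakk>x \<in> carrier H; y \<in> carrier H\<rbrakk> \<Longrightarrow>
      h (x \<sqinter>\<^bsub>ord_of H\<^esub> y) = h x \<sqinter>\<^bsub>ord_of ?P\<^esub> h y"
    using emb by (simp_all add: subdirect_embedding_def l_hom_def join_pres_def meet_pres_def)
  have hc: "h z \<in> carrier ?P" if "z \<in> carrier H" for z
    using hom_in_carrier[OF hom that] .
  have join_closed: "z \<squnion>\<^bsub>ord_of H\<^esub> w \<in> carrier H" and meet_closed: "z \<sqinter>\<^bsub>ord_of H\<^esub> w \<in> carrier H"
    if "z \<in> carrier H" "w \<in> carrier H" for z w
    using lattice_join[OF H.lat] lattice_meet[OF H.lat] that
    by (simp_all add: least_Upper_pair greatest_Lower_pair)
  have u: "?u \<in> carrier H" using x y by (simp add: join_closed meet_closed)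
  have "h ?u i = h \<one>\<^bsub>H\<^esub> i" if i: "i \<in> I" for i
  proof -
    define k where "k z = h z i" for z
    interpret Fi: totally_ordered_group "F i" by (rule F[OF i])
    have kc: "k z \<in> carrier (F i)" if "z \<in> carrier H" for z
      using hc[OF that] i by (auto simp: k_def)
    have kj: "k (z \<squnion>\<^bsub>ord_of H\<^esub> w) = k z \<squnion>\<^bsub>ord_of (F i)\<^esub> k w"
      and km: "k (z \<sqinter>\<^bsub>ord_of H\<^esub> w) = k z \<sqinter>\<^bsub>ord_of (F i)\<^esub> k w"
      and kmult: "k (z \<otimes>\<^bsub>H\<^esub> w) = k z \<otimes>\<^bsub>F i\<^esub> k w"
      if "z \<in> carrier H" "w \<in> carrier H" for z w
      using P(2,3)[OF _ hc hc] hom_mult[OF hom] that i by (simp_all add: k_def hj hm)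
    have khom: "k \<in> hom H (F i)" using kc kmult by (intro homI)
    \<comment> \<open>Preservation of products makes the coordinate map \<open>k\<close> a group
      homomorphism, which gives preservation of inverses and of the identity element as simp
      rules.\<close>
    interpret k: group_hom H "F i" k
      using khom by (intro group_hom.intro group_hom_axioms.intro H.is_group Fi.is_group)
    have "k ?u = (k x \<squnion>\<^bsub>ord_of (F i)\<^esub> \<one>\<^bsub>F i\<^esub>) \<sqinter>\<^bsub>ord_of (F i)\<^esub>
        (inv\<^bsub>F i\<^esub> k y \<otimes>\<^bsub>F i\<^esub> (inv\<^bsub>F i\<^esub> k x \<squnion>\<^bsub>ord_of (F i)\<^esub> \<one>\<^bsub>F i\<^esub>) \<otimes>\<^bsub>F i\<^esub> k y)"
      using x y by (simp add: kj km join_closed meet_closed)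
    also have "\<dots> = k \<one>\<^bsub>H\<^esub>"
      using totally_ordered_group_conj_identity[OF F[OF i] kc[OF x] kc[OF y]] by simp
    finally show ?thesis by (simp add: k_def)
  qed
  \<comment> \<open>Elements of the product are extensional functions, so agreement on
    \<open>I\<close> is equality.\<close>
  then have "h ?u = h \<one>\<^bsub>H\<^esub>"
    using hc[OF u] hc[OF H.one_closed] by (intro PiE_ext[of _ I "\<lambda>i. carrier (F i)"]) auto
  then show ?thesis using inj u by (auto dest: inj_onD)
qed

text \<open>The group is the product of a single factor, itself, embedded by constant functions on
  the one-point index set \<open>unit\<close>. \<open>representableI\<close> accepts this index
  type.\<close>

lemma totally_ordered_group_representable:
  assumes "totally_ordered_group H"
  shows "representable H"
proof -
  interpret totally_ordered_group H by fact
  let ?F = "\<lambda>_::unit. H" and ?I = "UNIV :: unit set" and ?h = "\<lambda>x (_::unit). x"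
  have P: "l_group (product_pogroup ?I ?F)"
    by (rule product_l_group(1)) (rule l_group_axioms)
  have c: "(\<lambda>_. x) \<in> carrier (product_pogroup ?I ?F)" if "x \<in> carrier H" for x
    using that by auto
  note jm = product_l_group(2,3)[OF l_group_axioms c c]
  have "?h \<in> l_hom H (product_pogroup ?I ?F)"
    using lat l_group.lat[OF P] by (simp add: l_hom_def hom_def Pi_def PiE_def join_pres_def meet_pres_def jm restrict_UNIV)
  then have "subdirect_embedding H ?I ?F ?h"
    by (auto simp: subdirect_embedding_def inj_on_def fun_eq_iff)
  with l_group_axioms assms show ?thesis by (intro representableI)
qed

section \<open>The right regular action on the chain of classes\<close>

locale right_preordered_group = po_group G for G :: "('a, 'm) pogroup_scheme" (structure) +
  fixes r :: "'a rel"
  assumes right_preorder: "right_preorder G r"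
begin

abbreviation cls :: "'a \<Rightarrow> 'a set" where
  "cls a \<equiv> (r \<inter> r\<inverse>) `` {a}"

abbreviation R :: "'a \<Rightarrow> 'a set \<Rightarrow> 'a set" where
  "R \<equiv> right_reg G r"

lemma cls_le_iff:
  "\<lbrakk>a \<in> carrier G; b \<in> carrier G\<rbrakk> \<Longrightarrow> cls a \<sqsubseteq>\<^bsub>Omega G r\<^esub> cls b \<longleftrightarrow> (a, b) \<in> r"
  using Omega_class_le_iff[OF right_preorder] .

lemma R_cls [simp]:
  "\<lbrakk>a \<in> carrier G; b \<in> carrier G\<rbrakk> \<Longrightarrow> R a (cls b) = cls (b \<otimes> a)"
  using right_reg_class[OF po_group_axioms right_preorder] .

lemma R_Aut: "a \<in> carrier G \<Longrightarrow> R a \<in> carrier (Aut (Omega G r))"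
  using right_reg_Aut[OF po_group_axioms right_preorder] .

lemma cls_in_Omega: "a \<in> carrier G \<Longrightarrow> cls a \<in> carrier (Omega G r)"
  by (simp add: quotientI)

lemma Omega_cases:
  assumes "X \<in> carrier (Omega G r)"
  obtains a where "a \<in> carrier G" "X = cls a"
  using assms by (auto simp: quotient_def)

text \<open>Multiplication in \<open>Aut\<close> applies the left factor first, so right translation
  is a homomorphism and not an anti-homomorphism.\<close>

lemma R_mult:
  assumes "a \<in> carrier G" "b \<in> carrier G"
  shows "R a \<otimes>\<^bsub>Aut (Omega G r)\<^esub> R b = R (a \<otimes> b)"
proof (rule extensionalityI)
  fix X assume X: "X \<in> carrier (Omega G r)"
  then obtain c where "c \<in> carrier G" "X = cls c" by (rule Omega_cases)
  then show "(R a \<otimes>\<^bsub>Aut (Omega G r)\<^esub> R b) X = R (a \<otimes> b) X"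
    using assms X by (simp add: compose_eq m_assoc)
qed (auto simp: compose_def right_reg_def)

lemma R_one: "R \<one> = \<one>\<^bsub>Aut (Omega G r)\<^esub>"
proof (rule extensionalityI)
  fix X assume X: "X \<in> carrier (Omega G r)"
  then obtain c where "c \<in> carrier G" "X = cls c" by (rule Omega_cases)
  then show "R \<one> X = \<one>\<^bsub>Aut (Omega G r)\<^esub> X"
    using X by simp
qed (auto simp: right_reg_def)

text \<open>Every point of the chain is the class of some c, which \<open>R a\<close> sends to the
  class of c a. The pre-order is assumed invariant under right translation only, so the left factor
  c cannot simply be cancelled.\<close>

lemma R_le_iff:
  assumes "a \<in> carrier G" "b \<in> carrier G"
  shows "R a \<preceq>\<^bsub>Aut (Omega G r)\<^esub> R b \<longleftrightarrow> (\<forall>c\<in>carrier G. (c \<otimes> a, c \<otimes> b) \<in> r)"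
proof -
  have "R a \<preceq>\<^bsub>Aut (Omega G r)\<^esub> R b \<longleftrightarrow>
      (\<forall>c\<in>carrier G. R a (cls c) \<sqsubseteq>\<^bsub>Omega G r\<^esub> R b (cls c))"
    unfolding Aut_simps using cls_in_Omega by (metis Omega_cases)
  then show ?thesis using assms by (simp add: cls_le_iff del: Omega_simps(3))
qed

text \<open>Translates condition (3) into the action: the right-hand side says that
  \<open>R a\<close> moves the class of b weakly up.\<close>

lemma conj_in_pre_cone_iff:
  assumes "a \<in> carrier G" "b \<in> carrier G"
  shows "b \<otimes> a \<otimes> inv b \<in> pre_cone G r \<longleftrightarrow> (b, b \<otimes> a) \<in> r"
  using right_preorder_iff_pre_cone[OF po_group_axioms right_preorder, of b "b \<otimes> a"] assms by simp

text \<open>The inverse of the conjugate is b (b a)^-1, so this is the pre-cone criterion with b and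
  b a exchanged: \<open>R a\<close> moves the class of b weakly down.\<close>

lemma conj_in_set_inv_pre_cone_iff:
  assumes "a \<in> carrier G" "b \<in> carrier G"
  shows "b \<otimes> a \<otimes> inv b \<in> set_inv (pre_cone G r) \<longleftrightarrow> (b \<otimes> a, b) \<in> r"
proof -
  have "b \<otimes> a \<otimes> inv b \<in> set_inv (pre_cone G r) \<longleftrightarrow> inv (b \<otimes> a \<otimes> inv b) \<in> pre_cone G r"
  proof
    assume "b \<otimes> a \<otimes> inv b \<in> set_inv (pre_cone G r)"
    then obtain h where "h \<in> pre_cone G r" "b \<otimes> a \<otimes> inv b = inv h" by (auto simp: SET_INV_def)
    then show "inv (b \<otimes> a \<otimes> inv b) \<in> pre_cone G r" by (simp add: pre_cone_def)
  next
    assume "inv (b \<otimes> a \<otimes> inv b) \<in> pre_cone G r"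
    moreover have "b \<otimes> a \<otimes> inv b = inv (inv (b \<otimes> a \<otimes> inv b))" using assms by simp
    ultimately show "b \<otimes> a \<otimes> inv b \<in> set_inv (pre_cone G r)" unfolding SET_INV_def by blast
  qed
  also have "inv (b \<otimes> a \<otimes> inv b) = b \<otimes> inv (b \<otimes> a)"
    using assms by (simp add: inv_mult_group m_assoc)
  finally show ?thesis
    using right_preorder_iff_pre_cone[OF po_group_axioms right_preorder, of "b \<otimes> a" b] assms by simp
qed

section \<open>Computing in the generated l-group\<close>

lemma H_l_subgroup: "l_subgroup (carrier (H_of G r)) (Aut (Omega G r))"
  and R_in_H: "a \<in> carrier G \<Longrightarrow> R a \<in> carrier (H_of G r)"
proof -
  have "R ` carrier G \<subseteq> carrier (Aut (Omega G r))" using R_Aut by blast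
  note * = l_generate_l_subgroup[OF Aut_l_group(1)[OF Omega_total_order[OF right_preorder]] this]
  show "l_subgroup (carrier (H_of G r)) (Aut (Omega G r))" using *(1) by (simp add: H_of_def)
  show "a \<in> carrier G \<Longrightarrow> R a \<in> carrier (H_of G r)" using *(2) by (auto simp: H_of_def)
qed

lemma H_simps [simp]:
  "mult (H_of G r) = mult (Aut (Omega G r))"
  "one (H_of G r) = one (Aut (Omega G r))"
  "leq (H_of G r) = leq (Aut (Omega G r))"
  by (simp_all add: H_of_def)

text \<open>An l-subgroup takes its joins and meets from \<open>Aut (Omega G r)\<close>, where they
  are pointwise because the classes form a chain. Identities in \<open>H_of G r\<close> can thus be
  tested at a single class.\<close>

lemma H_join_meet_apply:
  assumes "f \<in> carrier (H_of G r)" "g \<in> carrier (H_of G r)" "X \<in> carrier (Omega G r)"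
  shows "(f \<squnion>\<^bsub>ord_of (H_of G r)\<^esub> g) X = f X \<squnion>\<^bsub>Omega G r\<^esub> g X"
    and "(f \<sqinter>\<^bsub>ord_of (H_of G r)\<^esub> g) X = f X \<sqinter>\<^bsub>Omega G r\<^esub> g X"
proof -
  let ?A = "Aut (Omega G r)"
  have H: "H_of G r = ?A\<lparr>carrier := carrier (H_of G r)\<rparr>" by (simp add: H_of_def)
  note A = Aut_l_group[OF Omega_total_order[OF right_preorder]]
  have fg: "f \<in> carrier ?A" "g \<in> carrier ?A"
    using H_l_subgroup assms(1,2) by (auto simp: l_subgroup_def dest: subgroup.mem_carrier)
  have "f \<squnion>\<^bsub>ord_of (H_of G r)\<^esub> g = f \<squnion>\<^bsub>ord_of ?A\<^esub> g" "f \<sqinter>\<^bsub>ord_of (H_of G r)\<^esub> g = f \<sqinter>\<^bsub>ord_of ?A\<^esub> g"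
    using l_subgroup_l_group(2,3)[OF A(1) H_l_subgroup] assms(1,2) H by metis+
  then show "(f \<squnion>\<^bsub>ord_of (H_of G r)\<^esub> g) X = f X \<squnion>\<^bsub>Omega G r\<^esub> g X"
    and "(f \<sqinter>\<^bsub>ord_of (H_of G r)\<^esub> g) X = f X \<sqinter>\<^bsub>Omega G r\<^esub> g X"
    using A(2,3)[OF fg] assms(3) by simp_all
qed

lemma cls_join_meet:
  assumes "a \<in> carrier G" "b \<in> carrier G"
  shows "cls a \<squnion>\<^bsub>Omega G r\<^esub> cls b = (if (a, b) \<in> r then cls b else cls a)"
    and "cls a \<sqinter>\<^bsub>Omega G r\<^esub> cls b = (if (a, b) \<in> r then cls a else cls b)"
proof -
  interpret total_order "Omega G r" by (rule Omega_total_order[OF right_preorder])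
  note c = cls_in_Omega[OF assms(1)] cls_in_Omega[OF assms(2)]
  note jm = comparable_join_meet[OF partial_order_axioms c total_order_total[OF c]]
  show "cls a \<squnion>\<^bsub>Omega G r\<^esub> cls b = (if (a, b) \<in> r then cls b else cls a)"
    "cls a \<sqinter>\<^bsub>Omega G r\<^esub> cls b = (if (a, b) \<in> r then cls a else cls b)"
    using jm unfolding cls_le_iff[OF assms] .
qed

lemma inv_R:
  assumes "a \<in> carrier G"
  shows "inv\<^bsub>H_of G r\<^esub> R a = R (inv a)"
proof -
  interpret H: l_group "H_of G r" by (rule H_of_l_group[OF po_group_axioms right_preorder])
  have "R (inv a) \<otimes>\<^bsub>H_of G r\<^esub> R a = \<one>\<^bsub>H_of G r\<^esub>"
    using assms R_mult R_one by (simp del: Aut_simps)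
  then show ?thesis using assms by (intro H.inv_equality R_in_H) auto
qed

section \<open>The two implications through condition (3)\<close>

text \<open>In a counterexample both arguments of the meet, evaluated at the class of c, lie
  strictly above that class. In a chain their meet is one of them, so it is not the class of
  c.\<close>

lemma total_conj_if_representable:
  assumes rep: "representable (H_of G r)" and a: "a \<in> carrier G"
  shows "(\<forall>b\<in>carrier G. (b, b \<otimes> a) \<in> r) \<or> (\<forall>b\<in>carrier G. (b \<otimes> a, b) \<in> r)"
proof (rule ccontr)
  assume "\<not> ?thesis"
  \<comment> \<open>By totality, \<open>R a\<close> moves the class of b strictly down and the class
    of c strictly up.\<close>
  then obtain b c where b: "b \<in> carrier G" "(b, b \<otimes> a) \<notin> r" and c: "c \<in> carrier G" "(c \<otimes> a, c) \<notin> r"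
    by blast
  let ?H = "H_of G r"
  let ?v = "R (inv a) \<squnion>\<^bsub>ord_of ?H\<^esub> \<one>\<^bsub>?H\<^esub>"
  interpret H: l_group ?H by (rule H_of_l_group[OF po_group_axioms right_preorder])
  have join_closed: "f \<squnion>\<^bsub>ord_of ?H\<^esub> g \<in> carrier ?H" if "f \<in> carrier ?H" "g \<in> carrier ?H" for f g
    using lattice_join[OF H.lat] that by (simp add: least_Upper_pair)
  have one: "\<one>\<^bsub>?H\<^esub> = R \<one>" by (simp add: R_one)
  have v: "?v \<in> carrier ?H" using a R_in_H H.one_closed by (intro join_closed) auto
  \<comment> \<open>The witness is b^-1 c. Conjugating by \<open>R y\<close> carries what
    \<open>R (inv a)\<close> does at b over to c.\<close>
  obtain y where y: "y \<in> carrier G" "inv y \<in> carrier G" and cy: "c \<otimes> inv y = b" "b \<otimes> y = c"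
  proof
    show "c \<otimes> inv (inv b \<otimes> c) = b" "b \<otimes> (inv b \<otimes> c) = c"
      using b c by (simp_all add: inv_mult_group m_assoc[symmetric])
  qed (use b c in simp_all)
  have id: "(R a \<squnion>\<^bsub>ord_of ?H\<^esub> \<one>\<^bsub>?H\<^esub>) \<sqinter>\<^bsub>ord_of ?H\<^esub> (R (inv y) \<otimes>\<^bsub>?H\<^esub> ?v \<otimes>\<^bsub>?H\<^esub> R y) = \<one>\<^bsub>?H\<^esub>"
    using representable_conj_identity[OF rep R_in_H[OF a] R_in_H[OF y(1)]] inv_R a y(1) by simp
  have "(b \<otimes> inv a, b) \<in> r \<longleftrightarrow> (b, b \<otimes> a) \<in> r"
  proof -
    have tr: "(x \<otimes> t, z \<otimes> t) \<in> r" if "(x, z) \<in> r" "t \<in> carrier G" for x z t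
      using right_preorder that by (simp add: right_preorder_def)
    show ?thesis using tr[of "b \<otimes> inv a" b a] tr[of b "b \<otimes> a" "inv a"] a b by (auto simp: m_assoc)
  qed
  \<comment> \<open>Both sides of the equivalence fail by the choice of b, so the join selects the
    class of b a^-1.\<close>
  then have "?v (cls b) = cls (b \<otimes> inv a)"
    using H_join_meet_apply(1)[OF R_in_H R_in_H cls_in_Omega, of "inv a" \<one> b] a b
    by (simp add: one cls_join_meet del: H_simps)
  \<comment> \<open>Products act from left to right: the class of c goes to that of b, then to that
    of b a^-1, then to that of b a^-1 y.\<close>
  moreover have "(R (inv y) \<otimes>\<^bsub>?H\<^esub> ?v \<otimes>\<^bsub>?H\<^esub> R y) (cls c) = R y (?v (R (inv y) (cls c)))"
    using cls_in_Omega[OF c(1)] by (simp add: compose_eq)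
  ultimately have w: "(R (inv y) \<otimes>\<^bsub>?H\<^esub> ?v \<otimes>\<^bsub>?H\<^esub> R y) (cls c) = cls (b \<otimes> inv a \<otimes> y)"
    using a b c y cy by (simp del: H_simps)
  have u: "(R a \<squnion>\<^bsub>ord_of ?H\<^esub> \<one>\<^bsub>?H\<^esub>) (cls c) = cls (c \<otimes> a)"
    using H_join_meet_apply(1)[OF R_in_H R_in_H cls_in_Omega, of a \<one> c] a c
    by (simp add: one cls_join_meet del: H_simps)
  have "cls (c \<otimes> a) \<sqinter>\<^bsub>Omega G r\<^esub> cls (b \<otimes> inv a \<otimes> y) = \<one>\<^bsub>?H\<^esub> (cls c)"
    using H_join_meet_apply(2)[OF _ _ cls_in_Omega[OF c(1)],
        of "R a \<squnion>\<^bsub>ord_of ?H\<^esub> \<one>\<^bsub>?H\<^esub>" "R (inv y) \<otimes>\<^bsub>?H\<^esub> ?v \<otimes>\<^bsub>?H\<^esub> R y"]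
      join_closed v R_in_H a y H.one_closed H.m_closed id u w by metis
  also have "\<one>\<^bsub>?H\<^esub> (cls c) = cls c" using cls_in_Omega[OF c(1)] by simp
  finally have m: "cls (c \<otimes> a) \<sqinter>\<^bsub>Omega G r\<^esub> cls (b \<otimes> inv a \<otimes> y) = cls c" .
  \<comment> \<open>A meet of two classes is one of them. The first alternative contradicts the
    choice of c.\<close>
  then have "cls (c \<otimes> a) = cls c \<or> cls (b \<otimes> inv a \<otimes> y) = cls c"
    using a b c y by (simp add: cls_join_meet split: if_splits)
  then have "(c \<otimes> a, c) \<in> r \<or> (b \<otimes> inv a \<otimes> y, c) \<in> r"
    using eq_equiv_class[OF _ right_preorder_equiv[OF right_preorder] c(1)] by blast
  then have "(b \<otimes> inv a \<otimes> y, c) \<in> r" using c by blast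
  \<comment> \<open>Right translation by y^-1 a turns this pair into (b, b a), which the choice of b
    excludes.\<close>
  then have "(b \<otimes> inv a \<otimes> y \<otimes> (inv y \<otimes> a), c \<otimes> (inv y \<otimes> a)) \<in> r"
    using right_preorder y a by (simp add: right_preorder_def)
  moreover have "y \<otimes> (inv y \<otimes> a) = a" using m_assoc[of y "inv y" a] y a by simp
  then have "b \<otimes> inv a \<otimes> y \<otimes> (inv y \<otimes> a) = b" using a b y by (simp add: m_assoc)
  moreover have "c \<otimes> (inv y \<otimes> a) = b \<otimes> a"
    using m_assoc[of c "inv y" a] cy(1) a c y by simp
  ultimately show False using b by simp
qed

lemma totally_ordered_if_total_conj:
  assumes "\<forall>a\<in>carrier G. (\<forall>b\<in>carrier G. (b, b \<otimes> a) \<in> r) \<or> (\<forall>b\<in>carrier G. (b \<otimes> a, b) \<in> r)"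
  shows "totally_ordered_group (H_of G r)"
proof -
  let ?A = "Aut (Omega G r)"
  interpret H: l_group "H_of G r" by (rule H_of_l_group[OF po_group_axioms right_preorder])
  interpret A: l_group ?A by (rule Aut_l_group(1)[OF Omega_total_order[OF right_preorder]])
  \<comment> \<open>The hypothesis is applied to a^-1 b at the points d = c a. Since c a (a^-1 b) =
    c b, it compares c a with c b in the same direction for every c.\<close>
  have total: "R a \<preceq>\<^bsub>?A\<^esub> R b \<or> R b \<preceq>\<^bsub>?A\<^esub> R a" if ab: "a \<in> carrier G" "b \<in> carrier G" for a b
  proof -
    have cancel: "c \<otimes> a \<otimes> (inv a \<otimes> b) = c \<otimes> b" if "c \<in> carrier G" for c
      using ab that m_assoc[of a "inv a" b] by (simp add: m_assoc)
    have "(c \<otimes> a, c \<otimes> b) \<in> r" if "\<forall>d\<in>carrier G. (d, d \<otimes> (inv a \<otimes> b)) \<in> r" "c \<in> carrier G" for c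
      using that(1)[rule_format, of "c \<otimes> a"] cancel[OF that(2)] that(2) ab by simp
    moreover have "(c \<otimes> b, c \<otimes> a) \<in> r" if "\<forall>d\<in>carrier G. (d \<otimes> (inv a \<otimes> b), d) \<in> r" "c \<in> carrier G" for c
      using that(1)[rule_format, of "c \<otimes> a"] cancel[OF that(2)] that(2) ab by simp
    moreover have "(\<forall>d\<in>carrier G. (d, d \<otimes> (inv a \<otimes> b)) \<in> r) \<or> (\<forall>d\<in>carrier G. (d \<otimes> (inv a \<otimes> b), d) \<in> r)"
      using assms[rule_format, of "inv a \<otimes> b"] ab by simp
    ultimately show ?thesis
      unfolding R_le_iff[OF ab] R_le_iff[OF ab(2,1)] by blast
  qed
  have "subgroup (R ` carrier G) ?A"
  proof (rule A.subgroupI)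
    show "R ` carrier G \<subseteq> carrier ?A" using R_Aut by blast
    show "R ` carrier G \<noteq> {}" by auto
    fix f assume "f \<in> R ` carrier G"
    then obtain a where a: "a \<in> carrier G" "f = R a" by blast
    then have "inv\<^bsub>?A\<^esub> f = R (inv a)"
      using R_mult R_one R_Aut by (intro A.inv_equality) (simp_all del: Aut_simps)
    then show "inv\<^bsub>?A\<^esub> f \<in> R ` carrier G" using a by simp
    fix g assume "g \<in> R ` carrier G"
    then show "f \<otimes>\<^bsub>?A\<^esub> g \<in> R ` carrier G" using a R_mult by (auto simp del: Aut_simps)
  qed
  moreover have "f \<squnion>\<^bsub>ord_of ?A\<^esub> g \<in> R ` carrier G" "f \<sqinter>\<^bsub>ord_of ?A\<^esub> g \<in> R ` carrier G"
    if fg: "f \<in> R ` carrier G" "g \<in> R ` carrier G" for f g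
  proof -
    have c: "f \<in> carrier (ord_of ?A)" "g \<in> carrier (ord_of ?A)" using fg R_Aut by auto
    have "f \<sqsubseteq>\<^bsub>ord_of ?A\<^esub> g \<or> g \<sqsubseteq>\<^bsub>ord_of ?A\<^esub> f"
      unfolding ord_of_simps using fg total by blast
    \<comment> \<open>For comparable f and g, the join and the meet are f or g themselves.\<close>
    then show "f \<squnion>\<^bsub>ord_of ?A\<^esub> g \<in> R ` carrier G" "f \<sqinter>\<^bsub>ord_of ?A\<^esub> g \<in> R ` carrier G"
      using fg by (simp_all add: comparable_join_meet[OF A.ord c] del: ord_of_simps)
  qed
  ultimately have "l_subgroup (R ` carrier G) ?A" by (simp add: l_subgroup_def)
  \<comment> \<open>\<open>l_generate\<close> is the intersection of all l-subgroups containing the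
    generators, and the image of \<open>R\<close> is now one of them.\<close>
  then have sub: "carrier (H_of G r) \<subseteq> R ` carrier G"
    by (auto simp: H_of_def l_generate_def)
  have "total_order (ord_of (H_of G r))"
    using H.ord
  proof (rule partial_order.total_orderI)
    fix f g assume "f \<in> carrier (ord_of (H_of G r))" "g \<in> carrier (ord_of (H_of G r))"
    then show "f \<sqsubseteq>\<^bsub>ord_of (H_of G r)\<^esub> g \<or> g \<sqsubseteq>\<^bsub>ord_of (H_of G r)\<^esub> f"
      using sub total unfolding ord_of_simps H_simps by blast
  qed
  then show ?thesis
    by (intro totally_ordered_group.intro H.po_group_axioms totally_ordered_group_axioms.intro)
qed

end

theorem theorem6p1:
  fixes G :: "('a, 'm) pogroup_scheme" and r :: "'a rel"
  assumes "po_group G" and "right_preorder G r"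
  shows "(r \<in> P_R G \<longleftrightarrow> totally_ordered_group (H_of G r)) \<and>
    (totally_ordered_group (H_of G r) \<longleftrightarrow>
      (\<forall>a\<in>carrier G.
         (\<forall>b\<in>carrier G. b \<otimes>\<^bsub>G\<^esub> a \<otimes>\<^bsub>G\<^esub> inv\<^bsub>G\<^esub> b \<in> pre_cone G r) \<or>
         (\<forall>b\<in>carrier G. b \<otimes>\<^bsub>G\<^esub> a \<otimes>\<^bsub>G\<^esub> inv\<^bsub>G\<^esub> b \<in> set_inv\<^bsub>G\<^esub> (pre_cone G r))))"
proof -
  interpret right_preordered_group G r
    using assms by (intro right_preordered_group.intro right_preordered_group_axioms.intro)
  have "r \<in> P_R G \<longleftrightarrow> representable (H_of G r)"
    using right_preorder by (simp add: P_R_def)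
  moreover have "representable (H_of G r)" if "totally_ordered_group (H_of G r)"
    using that by (rule totally_ordered_group_representable)
  moreover have "\<forall>a\<in>carrier G. (\<forall>b\<in>carrier G. (b, b \<otimes>\<^bsub>G\<^esub> a) \<in> r) \<or> (\<forall>b\<in>carrier G. (b \<otimes>\<^bsub>G\<^esub> a, b) \<in> r)"
    if "representable (H_of G r)"
    using total_conj_if_representable[OF that] by blast
  moreover note totally_ordered_if_total_conj
  \<comment> \<open>The implications form a cycle: representable, condition (3), totally ordered,
    representable. The pre-cone criteria require a and b in the carrier, which
    \<open>ball_cong\<close> makes available under the bounded quantifiers.\<close>
  ultimately show ?thesis
    by (simp only: conj_in_pre_cone_iff conj_in_set_inv_pre_cone_iff cong: ball_cong) blast
qed

end
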